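(* Let $\mathbf{P}$ be any connected, essentially finite poset and let $F:\mathbf{P}\to\mathbf{vec}$ be interval decomposable. For every $I\in\mathbf{Con}(\mathbf{P})$, the value $$\mathrm{rk}(F)(I)-\sum_{J\in I^1}\mathrm{rk}(F)(J)+\sum_{K\in I^2}\mathrm{rk}(F)(K)-\cdots+(-1)^{o_I}\sum_{L\in I^{o_I}}\mathrm{rk}(F)(L)$$ is equal to the multiplicity of $I$ in the barcode $\mathrm{barc}^{\mathbf{P}}(F)$ (in particular, if $I\in\mathbf{Con}(\mathbf{P})\setminus\mathbf{Int}(\mathbf{P})$, then this value is zero).
   Context: Fix a field $\mathbb{F}$; $\mathbf{vec}$ (resp. $\mathbf{Vec}$) is the category of finite-dimensional (resp. all) vector spaces over $\mathbb{F}$. A poset is regarded as a category with a unique morphism $p\to q$ iff $p\le q$. Posets. A poset $\mathbf{P}$ is connected if any $p,q\in\mathbf{P}$ are joined by a finite sequence $p=p_0,\dots,p_n=q$ with $p_i,p_{i+1}$ comparable for all $i$. It is locally finite if $\{r: p\le r\le q\}$ is finite for all $p\le q$. Write $p\asymp q$ if one of $p,q$ covers the other ($p$ covers $q$ if $q<p$ and there is no $r$ with $q<r<p$). The Hasse diagram $\mathrm{Hasse}(\mathbf{P})$ is the simple graph on $\mathbf{P}$ with $p,q$ adjacent iff $p\asymp q$. $\mathbf{Con}(\mathbf{P})$ is the collection of all subposets $I\subset\mathbf{P}$ such that the induced subgraph of $\mathrm{Hasse}(\mathbf{P})$ on $I$ is a connected (nonempty) graph. $\mathbf{Int}(\mathbf{P})$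 is the collection of intervals of $\mathbf{P}$: nonempty subsets $\mathcal{J}$ that are connected as posets and convex ($r,t\in\mathcal{J}$, $r\le s\le t$ imply $s\in\mathcal{J}$). For $\mathbf{P}$ locally finite, $\mathbf{Int}(\mathbf{P})\subset\mathbf{Con}(\mathbf{P})$. For $I\in\mathbf{Con}(\mathbf{P})$, $\mathrm{nbd}(I)=\{p\in\mathbf{P}\setminus I:\exists q\in I,\ q\asymp p\}$, and the perimeter is $o_I=|\mathrm{nbd}(I)|$. $\mathbf{P}$ is essentially finite if it is locally finite and $o_I$ is finite for every $I\in\mathbf{Con}(\mathbf{P})$. For $n\ge1$, $I^n$ is the set of all $J$ with $I\subset J\subset I\cup\mathrm{nbd}(I)$ and $|J\cap\mathrm{nbd}(I)|=n$ (each such $J$ lies in $\mathbf{Con}(\mathbf{P})$). Rank invariant. For $I\in\mathbf{Con}(\mathbf{P})$, $\mathrm{rk}(F)(I)$ is the rank (dimension of the image) of the canonical map $\varprojlim F|_I\to\varinjlim F|_I$ in $\mathbf{Vec}$, i.e. the composite $\varprojlim F|_I\to F_a\to\varinjlim F|_I$ of the structure maps for any $a\in I$ (independent of $a$); it is a nonnegative integer. Interval decomposability. For an interval $\mathcal{J}$, the interval module $I^{\mathcal{J}}:\mathbf{P}\to\mathbf{vec}$ has value $\mathbb{F}$ on $\mathcal{J}$ and $0$ elsewhere, with identity maps between points of $\mathcal{J}$ and zero maps otherwise. $F$ is interval decomposable if $F\cong\bigoplus_{\mathcal{J}\in\mathrm{barc}^{\mathbf{P}}(F)}I^{\mathcal{J}}$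 for some multiset $\mathrm{barc}^{\mathbf{P}}(F)$ of intervals of $\mathbf{P}$; this multiset is unique and is called the barcode of $F$. *)

theory Defs
  imports "Jordan_Normal_Form.Missing_VectorSpace" "HOL-Algebra.AbelCoset"
begin

section \<open>Posets\<close>

text \<open>The ambient poset is a type of class \<open>order\<close>; subposets are sets with the induced order.\<close>

definition poset_connected :: "'p::order set \<Rightarrow> bool" where
  "poset_connected S \<longleftrightarrow> (\<forall>p\<in>S. \<forall>q\<in>S. (p, q) \<in> (Restr {(x, y). x \<le> y \<or> y \<le> x} S)\<^sup>*)"

definition locally_finite :: "'p::order itself \<Rightarrow> bool" where
  "locally_finite _ \<longleftrightarrow> (\<forall>p q :: 'p. p \<le> q \<longrightarrow> finite {r. p \<le> r \<and> r \<le> q})"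

definition covers :: "'p::order \<Rightarrow> 'p \<Rightarrow> bool" where
  "covers p q \<longleftrightarrow> q < p \<and> \<not> (\<exists>r. q < r \<and> r < p)"

definition hasse_adj :: "'p::order \<Rightarrow> 'p \<Rightarrow> bool" (infix "\<asymp>" 50) where
  "p \<asymp> q \<longleftrightarrow> covers p q \<or> covers q p"

definition Con :: "'p::order set set" where
  "Con = {I. I \<noteq> {} \<and> (\<forall>p\<in>I. \<forall>q\<in>I. (p, q) \<in> (Restr {(x, y). x \<asymp> y} I)\<^sup>*)}"

definition Intervals :: "'p::order set set" where
  "Intervals = {J. J \<noteq> {} \<and> poset_connected J \<and>
     (\<forall>r\<in>J. \<forall>t\<in>J. \<forall>s. r \<le> s \<and> s \<le> t \<longrightarrow> s \<in> J)}"

definition nbd :: "'p::order set \<Rightarrow> 'p set" where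
  "nbd I = {p. p \<notin> I \<and> (\<exists>q\<in>I. q \<asymp> p)}"

text \<open>The perimeter is used only when the neighbourhood is finite.\<close>

definition perimeter :: "'p::order set \<Rightarrow> nat" where
  "perimeter I = card (nbd I)"

definition essentially_finite :: "'p::order itself \<Rightarrow> bool" where
  "essentially_finite _ \<longleftrightarrow> locally_finite TYPE('p) \<and> (\<forall>I \<in> (Con :: 'p set set). finite (nbd I))"

definition enlargements :: "'p::order set \<Rightarrow> nat \<Rightarrow> 'p set set" where
  "enlargements I n = {J. I \<subseteq> J \<and> J \<subseteq> I \<union> nbd I \<and> card (J \<inter> nbd I) = n}"


section \<open>Vector spaces\<close>

text \<open>Vector spaces, linear maps and dimension are those of the AFP entry \<open>VectorSpace\<close>.
  A \<open>module\<close> record extends a ring record; its \<open>mult\<close> and \<open>one\<close> fields play no role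
  for a vector space and are left \<open>undefined\<close>. Elements of products are extensional functions.\<close>

definition pointwise_space ::
  "'a set \<Rightarrow> ('a \<Rightarrow> ('k, 'v) module) \<Rightarrow> ('a \<Rightarrow> 'v) set \<Rightarrow> ('k, 'a \<Rightarrow> 'v) module" where
  "pointwise_space A V C = \<lparr>carrier = C, mult = undefined, one = undefined,
     zero = (\<lambda>i\<in>A. \<zero>\<^bsub>V i\<^esub>),
     add = (\<lambda>s t. \<lambda>i\<in>A. s i \<oplus>\<^bsub>V i\<^esub> t i),
     smult = (\<lambda>c s. \<lambda>i\<in>A. c \<odot>\<^bsub>V i\<^esub> s i)\<rparr>"

definition direct_sum_space ::
  "'a set \<Rightarrow> ('a \<Rightarrow> ('k, 'v) module) \<Rightarrow> ('k, 'a \<Rightarrow> 'v) module" where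
  "direct_sum_space A V = pointwise_space A V
     {s \<in> (\<Pi>\<^sub>E i\<in>A. carrier (V i)). finite {i\<in>A. s i \<noteq> \<zero>\<^bsub>V i\<^esub>}}"

definition direct_sum_inj ::
  "'a set \<Rightarrow> ('a \<Rightarrow> ('k, 'v) module) \<Rightarrow> 'a \<Rightarrow> 'v \<Rightarrow> 'a \<Rightarrow> 'v" where
  "direct_sum_inj A V a v = (\<lambda>i\<in>A. if i = a then v else \<zero>\<^bsub>V i\<^esub>)"

text \<open>The scalar multiple of a coset is the union of the cosets of the scalar multiples of its
  elements, which for a subspace \<open>N\<close> is a single coset.\<close>

definition quotient_space :: "('k, 'v) module \<Rightarrow> 'v set \<Rightarrow> ('k, 'v set) module" where
  "quotient_space V N = \<lparr>carrier = a_rcosets\<^bsub>V\<^esub> N, mult = undefined, one = undefined,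
     zero = N,
     add = (\<lambda>A B. A <+>\<^bsub>V\<^esub> B),
     smult = (\<lambda>c A. \<Union>x\<in>A. N +>\<^bsub>V\<^esub> (c \<odot>\<^bsub>V\<^esub> x))\<rparr>"


section \<open>Persistence modules\<close>

text \<open>A functor from the poset \<open>'p\<close> to vector spaces: \<open>obj F p\<close> is the space at \<open>p\<close>, with its own
  carrier and operations, and \<open>arr F p q\<close> is the structure map for \<open>p \<le> q\<close>.\<close>

record ('p, 'k, 'v) diagram =
  obj :: "'p \<Rightarrow> ('k, 'v) module"
  arr :: "'p \<Rightarrow> 'p \<Rightarrow> 'v \<Rightarrow> 'v"

definition functor_to_vec ::
  "('k, 'm) ring_scheme \<Rightarrow> ('p::order, 'k, 'v) diagram \<Rightarrow> bool" where
  "functor_to_vec K F \<longleftrightarrow>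
     (\<forall>p. vectorspace K (obj F p) \<and> vectorspace.fin_dim K (obj F p)) \<and>
     (\<forall>p q. p \<le> q \<longrightarrow> linear_map K (obj F p) (obj F q) (arr F p q)) \<and>
     (\<forall>p. \<forall>x\<in>carrier (obj F p). arr F p p x = x) \<and>
     (\<forall>p q r. p \<le> q \<and> q \<le> r \<longrightarrow>
        (\<forall>x\<in>carrier (obj F p). arr F q r (arr F p q x) = arr F p r x))"

definition diagram_iso ::
  "('k, 'm) ring_scheme \<Rightarrow> ('p::order, 'k, 'v) diagram \<Rightarrow> ('p, 'k, 'w) diagram \<Rightarrow> bool" where
  "diagram_iso K F G \<longleftrightarrow> (\<exists>\<eta>.
     (\<forall>p. linear_map K (obj F p) (obj G p) (\<eta> p) \<and>
          bij_betw (\<eta> p) (carrier (obj F p)) (carrier (obj G p))) \<and>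
     (\<forall>p q. p \<le> q \<longrightarrow> (\<forall>x\<in>carrier (obj F p). \<eta> q (arr F p q x) = arr G p q (\<eta> p x))))"

definition diagram_direct_sum ::
  "'a set \<Rightarrow> ('a \<Rightarrow> ('p, 'k, 'v) diagram) \<Rightarrow> ('p, 'k, 'a \<Rightarrow> 'v) diagram" where
  "diagram_direct_sum A G = \<lparr>
     obj = (\<lambda>p. direct_sum_space A (\<lambda>a. obj (G a) p)),
     arr = (\<lambda>p q s. \<lambda>a\<in>A. arr (G a) p q (s a))\<rparr>"


section \<open>The rank invariant\<close>

definition limit_space :: "('p::order, 'k, 'v) diagram \<Rightarrow> 'p set \<Rightarrow> ('k, 'p \<Rightarrow> 'v) module" where
  "limit_space F I = pointwise_space I (obj F)
     {s \<in> (\<Pi>\<^sub>E p\<in>I. carrier (obj F p)). \<forall>p\<in>I. \<forall>q\<in>I. p \<le> q \<longrightarrow> arr F p q (s p) = s q}"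

definition colimit_relations ::
  "('k, 'm) ring_scheme \<Rightarrow> ('p::order, 'k, 'v) diagram \<Rightarrow> 'p set \<Rightarrow> ('p \<Rightarrow> 'v) set" where
  "colimit_relations K F I = (let D = direct_sum_space I (obj F); \<iota> = direct_sum_inj I (obj F) in
     module.span K D
       {\<iota> p v \<ominus>\<^bsub>D\<^esub> \<iota> q (arr F p q v) | p q v. p \<in> I \<and> q \<in> I \<and> p \<le> q \<and> v \<in> carrier (obj F p)})"

definition colimit_space ::
  "('k, 'm) ring_scheme \<Rightarrow> ('p::order, 'k, 'v) diagram \<Rightarrow> 'p set \<Rightarrow> ('k, ('p \<Rightarrow> 'v) set) module" where
  "colimit_space K F I = quotient_space (direct_sum_space I (obj F)) (colimit_relations K F I)"

definition colimit_map ::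
  "('k, 'm) ring_scheme \<Rightarrow> ('p::order, 'k, 'v) diagram \<Rightarrow> 'p set \<Rightarrow> 'p \<Rightarrow> 'v \<Rightarrow> ('p \<Rightarrow> 'v) set" where
  "colimit_map K F I a v =
     colimit_relations K F I +>\<^bsub>direct_sum_space I (obj F)\<^esub> direct_sum_inj I (obj F) a v"

text \<open>For \<open>I \<in> Con\<close> the composite through \<open>obj F a\<close> does not depend on the chosen \<open>a \<in> I\<close>.\<close>

definition limit_to_colimit ::
  "('k, 'm) ring_scheme \<Rightarrow> ('p::order, 'k, 'v) diagram \<Rightarrow> 'p set \<Rightarrow> ('p \<Rightarrow> 'v) \<Rightarrow> ('p \<Rightarrow> 'v) set" where
  "limit_to_colimit K F I s = (let a = (SOME a. a \<in> I) in colimit_map K F I a (s a))"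

definition rk :: "('k, 'm) ring_scheme \<Rightarrow> ('p::order, 'k, 'v) diagram \<Rightarrow> 'p set \<Rightarrow> nat" where
  "rk K F I = vectorspace.dim K
     (colimit_space K F I\<lparr>carrier := limit_to_colimit K F I ` carrier (limit_space F I)\<rparr>)"


section \<open>Interval decomposability\<close>

definition interval_module ::
  "('k, 'm) ring_scheme \<Rightarrow> 'p::order set \<Rightarrow> ('p, 'k, 'k) diagram" where
  "interval_module K J = \<lparr>
     obj = (\<lambda>p. \<lparr>carrier = (if p \<in> J then carrier K else {\<zero>\<^bsub>K\<^esub>}), mult = undefined, one = undefined,
                 zero = \<zero>\<^bsub>K\<^esub>, add = add K, smult = mult K\<rparr>),
     arr = (\<lambda>p q x. if p \<in> J \<and> q \<in> J then x else \<zero>\<^bsub>K\<^esub>)\<rparr>"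

text \<open>A multiset of intervals, possibly infinite, is given by its multiplicity function \<open>m\<close>; the pairs
  \<open>(J, i)\<close> with \<open>i < m J\<close> index its elements. Multiplicities are finite because the
  functors considered have finite-dimensional values and intervals are nonempty.\<close>

definition has_barcode ::
  "('k, 'm) ring_scheme \<Rightarrow> ('p::order, 'k, 'v) diagram \<Rightarrow> ('p set \<Rightarrow> nat) \<Rightarrow> bool" where
  "has_barcode K F m \<longleftrightarrow> (\<forall>J. 0 < m J \<longrightarrow> J \<in> Intervals) \<and>
     diagram_iso K F
       (diagram_direct_sum {(J, i). i < m J} (\<lambda>(J, i). interval_module K J))"

definition interval_decomposable ::
  "('k, 'm) ring_scheme \<Rightarrow> ('p::order, 'k, 'v) diagram \<Rightarrow> bool" where
  "interval_decomposable K F \<longleftrightarrow> (\<exists>m. has_barcode K F m)"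

definition barcode ::
  "('k, 'm) ring_scheme \<Rightarrow> ('p::order, 'k, 'v) diagram \<Rightarrow> 'p set \<Rightarrow> nat" where
  "barcode K F = (THE m. has_barcode K F m)"

end

theory Submission
  imports Defs
begin

text \<open>
  If \<open>F\<close> is a direct sum of interval modules, then for connected \<open>J\<close> the rank \<open>rk F J\<close> is the number
  of summands whose interval contains \<open>J\<close>: these contribute the constant sections along \<open>J\<close>, whose
  classes in the colimit are detected by the coordinate functionals, while a section of any other
  summand vanishes somewhere on \<open>J\<close> and so has class zero. In the alternating sum a summand
  with interval \<open>B \<supseteq> I\<close> therefore contributes \<open>\<Sum> (-1) ^ card T\<close> over the subsets \<open>T\<close> of \<open>nbd I \<inter> B\<close>, which
  is \<open>0\<close> unless \<open>B\<close> misses \<open>nbd I\<close>, and since \<open>B\<close> is connected in the Hasse diagram that means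
  \<open>B = I\<close>. The argument applies to every decomposition of \<open>F\<close>, so it also proves that the barcode
  is unique.
\<close>

section \<open>Finite function spaces\<close>

text \<open>Evaluation at a point is additive, so it commutes with finite sums. This reduces a
  linear combination of functions to an identity in the ring at each point.\<close>

lemma (in cring) finsum_apply_func_space:
  fixes S :: "'z set"
  assumes "finite X" and "f \<in> X \<rightarrow> carrier (func_space S)" and "b \<in> S"
  shows "finsum (func_space S) f X b = (\<Oplus>\<^bsub>R\<^esub>x\<in>X. f x b)"
proof -
  interpret fs: module R "func_space S" by (rule func_space_is_module)
  have mem: "g b \<in> carrier R" if "g \<in> carrier (func_space S)" for g
    using that \<open>b \<in> S\<close> by (auto simp: func_space_def)
  from assms(1,2) show ?thesis
  proof (induction X rule: finite_induct)
    case empty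
    have "\<zero>\<^bsub>func_space S\<^esub> b = \<zero>"
      using \<open>b \<in> S\<close> by (simp add: func_space_def)
    then show ?case by simp
  next
    case (insert x X)
    have "finsum (func_space S) f (insert x X) b = (f x \<oplus>\<^bsub>func_space S\<^esub> finsum (func_space S) f X) b"
      using insert by (subst fs.finsum_insert) auto
    also have "\<dots> = f x b \<oplus> finsum (func_space S) f X b"
      using \<open>b \<in> S\<close> by (simp add: func_space_def)
    also have "\<dots> = (\<Oplus>y\<in>insert x X. f y b)"
      using insert mem by (subst finsum_insert) (auto simp: Pi_iff)
    finally show ?case .
  qed
qed

text \<open>The indicator functions of the points of \<open>S\<close> form a basis, because the
  value of a linear combination at \<open>b\<close> is exactly the coefficient of the indicator of
  \<open>b\<close>.\<close>

lemma (in field) dim_func_space: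
  fixes S :: "'z set"
  assumes "finite S"
  shows "vectorspace.dim R (func_space S) = card S" and "vectorspace.fin_dim R (func_space S)"
proof -
  interpret fs: vectorspace R "func_space S"
    by (intro vectorspace.intro func_space_is_module field_axioms)
  define unit where "unit b = (\<lambda>x\<in>S. if x = b then \<one> else \<zero>)" for b
  have unit_closed: "unit ` S \<subseteq> carrier (func_space S)"
    by (auto simp: unit_def func_space_def)
  have unit_one: "unit x x = \<one>" if "x \<in> S" for x
    using that by (simp add: unit_def)
  have inj: "inj_on unit S"
  proof (rule inj_onI)
    fix x y assume "x \<in> S" "y \<in> S" "unit x = unit y"
    then have "unit y x = \<one>"
      by (metis (no_types, lifting) unit_one)
    then show "x = y"
      using \<open>x \<in> S\<close> by (auto simp: unit_def split: if_splits)
  qed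
  have lincomb: "fs.module.lincomb a (unit ` S) b = a (unit b)"
    if a: "a \<in> unit ` S \<rightarrow> carrier R" and b: "b \<in> S" for a b
  proof -
    have au: "a (unit x) \<in> carrier R" if "x \<in> S" for x
      using that a by auto
    have "a u \<odot>\<^bsub>func_space S\<^esub> u \<in> carrier (func_space S)" if "u \<in> unit ` S" for u
      using that a unit_closed by (intro fs.smult_closed) auto
    then have "fs.module.lincomb a (unit ` S) b = (\<Oplus>u\<in>unit ` S. (a u \<odot>\<^bsub>func_space S\<^esub> u) b)"
      unfolding fs.module.lincomb_def
      using \<open>finite S\<close> b by (intro finsum_apply_func_space) auto
    also have "\<dots> = (\<Oplus>x\<in>S. (a (unit x) \<odot>\<^bsub>func_space S\<^esub> unit x) b)"
      using inj au b unit_closed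
      by (intro finsum_reindex) (auto simp: func_space_def)
    also have "\<dots> = (\<Oplus>x\<in>S. if b = x then a (unit x) else \<zero>)"
    proof (rule finsum_cong')
      fix x assume "x \<in> S"
      then show "(a (unit x) \<odot>\<^bsub>func_space S\<^esub> unit x) b = (if b = x then a (unit x) else \<zero>)"
        using au b by (simp add: func_space_def) (simp add: unit_def)
    qed (use au in auto)
    also have "\<dots> = a (unit b)"
      using a b \<open>finite S\<close> by (intro finsum_singleton) auto
    finally show ?thesis .
  qed
  have "fs.basis (unit ` S)"
    unfolding fs.basis_def
  proof (intro conjI)
    show "\<not> fs.lin_dep (unit ` S)"
    proof (rule fs.finite_lin_indpt2)
      fix a assume a: "a \<in> unit ` S \<rightarrow> carrier R"
        and "fs.module.lincomb a (unit ` S) = \<zero>\<^bsub>func_space S\<^esub>"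
      then show "\<forall>v\<in>unit ` S. a v = \<zero>"
        using lincomb[OF a] by (auto simp: func_space_def)
    qed (use \<open>finite S\<close> unit_closed in auto)
    show "fs.span (unit ` S) = carrier (func_space S)"
    proof (intro equalityI subsetI)
      fix f assume f: "f \<in> carrier (func_space S)"
      \<comment> \<open>The coefficient of the indicator of a point has to be the value of
        \<open>f\<close> at that point; inverting \<open>unit\<close> recovers the point from its
        indicator.\<close>
      define a where "a u = f (the_inv_into S unit u)" for u
      have a_unit: "a (unit b) = f b" if "b \<in> S" for b
        using that inj by (simp add: a_def the_inv_into_f_f)
      then have a: "a \<in> unit ` S \<rightarrow> carrier R"
        using f by (auto simp: func_space_def)
      have "fs.module.lincomb a (unit ` S) \<in> carrier (func_space S)"
        using a unit_closed by (rule fs.lincomb_closed[rotated])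
      then have "fs.module.lincomb a (unit ` S) = f"
        using f lincomb[OF a] a_unit
        by (intro extensionalityI[of _ S]) (auto simp: func_space_def PiE_iff)
      then show "f \<in> fs.span (unit ` S)"
        using a \<open>finite S\<close> unfolding fs.span_def by blast
    qed (use unit_closed fs.span_closed in blast)
  qed (use unit_closed in auto)
  then show "fs.dim = card S" "fs.fin_dim"
    using fs.dim_basis[of "unit ` S"] inj \<open>finite S\<close> card_image[OF inj]
    unfolding fs.fin_dim_def fs.basis_def by (auto intro!: exI[of _ "unit ` S"])
qed

text \<open>Rank-nullity with trivial kernel. The image is written as a record update on
  \<open>W\<close> to match the form of \<open>rk\<close>.\<close>

lemma dim_image_func_space:
  assumes "linear_map K (ring.func_space K S) W T" and "finite S"
    and "inj_on T (carrier (ring.func_space K S))"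
  shows "vectorspace.dim K (W\<lparr>carrier := T ` carrier (ring.func_space K S)\<rparr>) = card S"
proof -
  interpret T: linear_map K "ring.func_space K S" W T by fact
  note dim = field.dim_func_space[OF vectorspace.axioms(2)[OF linear_map.axioms(1)[OF assms(1)]]]
  have "vectorspace.dim K (W\<lparr>carrier := T.imT\<rparr>) + 0 = T.V.dim"
    using T.rank_nullity dim(2)[OF \<open>finite S\<close>] T.inj_imp_dim_ker0[OF assms(3)]
    by metis
  then show ?thesis
    using dim(1)[OF \<open>finite S\<close>] by (simp add: T.im_def)
qed

text \<open>Rank-nullity again; it will bound the number of supports through a point by the
  dimension of the space there.\<close>

lemma card_le_dim_if_surj_func_space:
  assumes "linear_map K V (ring.func_space K S) T" and "finite S"
    and "vectorspace.fin_dim K V" and "T ` carrier V = carrier (ring.func_space K S)"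
  shows "card S \<le> vectorspace.dim K V"
proof -
  interpret T: linear_map K V "ring.func_space K S" T by fact
  note dim = field.dim_func_space[OF vectorspace.axioms(2)[OF linear_map.axioms(1)[OF assms(1)]]]
  have "ring.func_space K S\<lparr>carrier := T.imT\<rparr> = ring.func_space K S"
    using assms(4) by (simp add: T.im_def)
  then show ?thesis
    using T.rank_nullity[OF assms(3)] dim(1)[OF \<open>finite S\<close>] by simp
qed

section \<open>Quotients and direct sums of vector spaces\<close>

locale vector_quotient = vectorspace K V
  for K and V :: "('k, 'v) module" (structure) +
  fixes N
  assumes subspace_N: "subspace K N V"
begin

lemma submodule_N: "submodule K N V"
  using subspace_N by simp

lemma abelian_subgroup_N: "abelian_subgroup N V"
proof (rule abelian_subgroupI3)
  interpret N: module K "V\<lparr>carrier := N\<rparr>"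
    by (rule submodule_is_module[OF submodule_N])
  show "additive_subgroup N V"
  proof (rule additive_subgroup.intro, rule add.subgroupI)
    show "N \<subseteq> carrier V" "N \<noteq> {}"
      using submodule_N by (auto simp: submodule_def)
    fix x assume x: "x \<in> N"
    \<comment> \<open>Negation is scaling by minus one, under which a submodule is closed.\<close>
    then have "\<ominus>\<^bsub>K\<^esub> \<one>\<^bsub>K\<^esub> \<odot> x \<in> N"
      using submodule_N by (auto simp: submodule_def)
    moreover have "\<ominus>\<^bsub>K\<^esub> \<one>\<^bsub>K\<^esub> \<odot> x = \<ominus> x"
      using x submodule_N smult_minus_1 by (auto simp: submodule_def)
    ultimately show "\<ominus> x \<in> N" by simp
  qed (use submodule_N in \<open>auto simp: submodule_def\<close>)
qed (rule abelian_group_axioms)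

sublocale N: abelian_subgroup N V
  by (rule abelian_subgroup_N)

lemma coset_eq_iff:
  assumes "x \<in> carrier V" "y \<in> carrier V"
  shows "N +> x = N +> y \<longleftrightarrow> x \<ominus> y \<in> N"
  using assms N.a_rcos_module N.a_repr_independence' N.a_repr_independenceD
  by (metis a_minus_def)

lemma coset_eq_N_iff:
  assumes "x \<in> carrier V"
  shows "N +> x = N \<longleftrightarrow> x \<in> N"
  using assms N.a_rcos_const N.a_rcos_self by metis

text \<open>All cosets in the union that defines scalar multiplication coincide: for
  \<open>y\<close> in the coset of \<open>x\<close>, the vectors \<open>c \<odot> y\<close> and
  \<open>c \<odot> x\<close> differ by \<open>c\<close> times an element of
  \<open>N\<close>.\<close>

lemma smult_coset:
  assumes "c \<in> carrier K" "x \<in> carrier V"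
  shows "c \<odot>\<^bsub>quotient_space V N\<^esub> (N +> x) = N +> (c \<odot> x)"
proof -
  have "N +> (c \<odot> y) = N +> (c \<odot> x)" if "y \<in> N +> x" for y
  proof -
    have y: "y \<in> carrier V"
      using assms(2) that by (rule N.a_elemrcos_carrier)
    have "y \<ominus> x \<in> N"
      using that assms y N.a_rcos_module[of x y] by (simp add: a_minus_def)
    then have "c \<odot> (y \<ominus> x) \<in> N"
      using submodule_N assms(1) unfolding submodule_def by blast
    moreover have "c \<odot> (y \<ominus> x) = c \<odot> y \<ominus> c \<odot> x"
      using assms y by (simp add: a_minus_def smult_r_distr smult_r_minus)
    ultimately show ?thesis
      using assms y coset_eq_iff[of "c \<odot> y" "c \<odot> x"] by (simp add: smult_closed)
  qed
  then have "(\<Union>y\<in>N +> x. N +> (c \<odot> y)) = (\<Union>y\<in>N +> x. N +> (c \<odot> x))"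
    by (intro SUP_cong refl)
  also have "\<dots> = N +> (c \<odot> x)"
    using N.a_rcos_self[OF assms(2)] by blast
  finally show ?thesis
    by (simp add: quotient_space_def)
qed

lemma add_coset:
  assumes "x \<in> carrier V" "y \<in> carrier V"
  shows "(N +> x) \<oplus>\<^bsub>quotient_space V N\<^esub> (N +> y) = N +> (x \<oplus> y)"
  using assms by (simp add: quotient_space_def N.a_rcos_sum)

lemma carrier_quotient_space: "carrier (quotient_space V N) = (\<lambda>x. N +> x) ` carrier V"
  by (auto simp: quotient_space_def A_RCOSETS_def')

lemma zero_quotient_space: "\<zero>\<^bsub>quotient_space V N\<^esub> = N +> \<zero>"
  by (simp add: quotient_space_def N.a_subset)

lemma vectorspace_quotient_space: "vectorspace K (quotient_space V N)"
proof (rule vs_criteria)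
  show "\<forall>v\<in>carrier (quotient_space V N). \<exists>w\<in>carrier (quotient_space V N).
      v \<oplus>\<^bsub>quotient_space V N\<^esub> w = \<zero>\<^bsub>quotient_space V N\<^esub>"
  proof
    fix v assume "v \<in> carrier (quotient_space V N)"
    then obtain x where x: "x \<in> carrier V" "v = N +> x"
      by (auto simp: carrier_quotient_space)
    then show "\<exists>w\<in>carrier (quotient_space V N).
        v \<oplus>\<^bsub>quotient_space V N\<^esub> w = \<zero>\<^bsub>quotient_space V N\<^esub>"
      by (intro bexI[of _ "N +> (\<ominus> x)"])
        (auto simp: add_coset zero_quotient_space carrier_quotient_space r_neg)
  qed
qed (auto simp: carrier_quotient_space zero_quotient_space add_coset smult_coset a_ac
      smult_l_distr smult_r_distr smult_assoc1 intro!: field_axioms)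

lemma linear_map_coset: "linear_map K V (quotient_space V N) (\<lambda>x. N +> x)"
proof -
  interpret Q: vectorspace K "quotient_space V N"
    by (rule vectorspace_quotient_space)
  show ?thesis
    by unfold_locales (auto simp: module_hom_def add_coset smult_coset carrier_quotient_space)
qed

end

section \<open>Direct sums of families of vector spaces\<close>

locale vector_direct_sum =
  fixes K :: "('k, 'm) ring_scheme" and A :: "'a set" and V :: "'a \<Rightarrow> ('k, 'v) module"
  assumes field_K: "field K"
    and vectorspace_V: "\<And>i. i \<in> A \<Longrightarrow> vectorspace K (V i)"
begin

abbreviation "D \<equiv> direct_sum_space A V"

lemma carrier_direct_sum:
  "carrier D = {s \<in> (\<Pi>\<^sub>E i\<in>A. carrier (V i)). finite {i\<in>A. s i \<noteq> \<zero>\<^bsub>V i\<^esub>}}"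
  and add_direct_sum: "s \<oplus>\<^bsub>D\<^esub> t = (\<lambda>i\<in>A. s i \<oplus>\<^bsub>V i\<^esub> t i)"
  and smult_direct_sum: "c \<odot>\<^bsub>D\<^esub> s = (\<lambda>i\<in>A. c \<odot>\<^bsub>V i\<^esub> s i)"
  and zero_direct_sum: "\<zero>\<^bsub>D\<^esub> = (\<lambda>i\<in>A. \<zero>\<^bsub>V i\<^esub>)"
  by (simp_all add: direct_sum_space_def pointwise_space_def)

lemma vectorspace_direct_sum: "vectorspace K D"
proof -
  interpret K: field K by (rule field_K)
  note V = vectorspace_V[unfolded vectorspace_def]
  have mod: "module K (V i)" if "i \<in> A" for i
    using V[OF that] by simp
  have ab: "abelian_group (V i)" if "i \<in> A" for i
    using V[OF that] by (simp add: module_def)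
  note ac = ab[THEN abelian_group.axioms(1)]
  have zero: "\<zero>\<^bsub>V i\<^esub> \<in> carrier (V i)" if "i \<in> A" for i
    using ac[OF that] by (rule abelian_monoid.zero_closed)
  have zero_add[simp]: "\<zero>\<^bsub>V i\<^esub> \<oplus>\<^bsub>V i\<^esub> \<zero>\<^bsub>V i\<^esub> = \<zero>\<^bsub>V i\<^esub>" if "i \<in> A" for i
    using ac[OF that] zero[OF that] by (simp add: abelian_monoid.l_zero)
  have smult_zero[simp]: "c \<odot>\<^bsub>V i\<^esub> \<zero>\<^bsub>V i\<^esub> = \<zero>\<^bsub>V i\<^esub>" if "i \<in> A" "c \<in> carrier K" for c i
    using V[OF that(1)] that(2) module.smult_r_null[of K "V i" c] by blast
  have neg_zero[simp]: "\<ominus>\<^bsub>V i\<^esub> \<zero>\<^bsub>V i\<^esub> = \<zero>\<^bsub>V i\<^esub>" if "i \<in> A" for i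
    using monoid.inv_one[OF group.is_monoid[OF abelian_group.a_group[OF ab[OF that]]]] by (simp add: a_inv_def)
  show ?thesis
  proof (rule vs_criteria)
    show "field K" by (rule field_K)
    show "\<zero>\<^bsub>D\<^esub> \<in> carrier D"
      using zero by (auto simp: carrier_direct_sum zero_direct_sum)
    show "\<forall>v w. v \<in> carrier D \<and> w \<in> carrier D \<longrightarrow> v \<oplus>\<^bsub>D\<^esub> w \<in> carrier D"
    proof (intro allI impI, elim conjE)
      fix v w assume vw: "v \<in> carrier D" "w \<in> carrier D"
      then have "finite ({i\<in>A. v i \<noteq> \<zero>\<^bsub>V i\<^esub>} \<union> {i\<in>A. w i \<noteq> \<zero>\<^bsub>V i\<^esub>})"
        by (auto simp: carrier_direct_sum)
      then have "finite {i\<in>A. (v \<oplus>\<^bsub>D\<^esub> w) i \<noteq> \<zero>\<^bsub>V i\<^esub>}"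
        by (rule rev_finite_subset) (auto simp: add_direct_sum)
      then show "v \<oplus>\<^bsub>D\<^esub> w \<in> carrier D"
        using vw ac abelian_monoid.a_closed
        by (fastforce simp: carrier_direct_sum add_direct_sum)
    qed
    show "\<forall>c v. c \<in> carrier K \<and> v \<in> carrier D \<longrightarrow> c \<odot>\<^bsub>D\<^esub> v \<in> carrier D"
    proof (intro allI impI, elim conjE)
      fix c v assume cv: "c \<in> carrier K" "v \<in> carrier D"
      then have "finite {i\<in>A. v i \<noteq> \<zero>\<^bsub>V i\<^esub>}"
        by (auto simp: carrier_direct_sum)
      then have "finite {i\<in>A. (c \<odot>\<^bsub>D\<^esub> v) i \<noteq> \<zero>\<^bsub>V i\<^esub>}"
        by (rule rev_finite_subset) (use cv in \<open>auto simp: smult_direct_sum\<close>)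
      then show "c \<odot>\<^bsub>D\<^esub> v \<in> carrier D"
        using cv V module.smult_closed
        by (fastforce simp: carrier_direct_sum smult_direct_sum)
    qed
    show "\<forall>v\<in>carrier D. \<exists>w\<in>carrier D. v \<oplus>\<^bsub>D\<^esub> w = \<zero>\<^bsub>D\<^esub>"
    proof
      fix v assume v: "v \<in> carrier D"
      then have "finite {i\<in>A. v i \<noteq> \<zero>\<^bsub>V i\<^esub>}"
        by (auto simp: carrier_direct_sum)
      then have "finite {i\<in>A. (\<lambda>i\<in>A. \<ominus>\<^bsub>V i\<^esub> v i) i \<noteq> \<zero>\<^bsub>V i\<^esub>}"
        by (rule rev_finite_subset) auto
      then have "(\<lambda>i\<in>A. \<ominus>\<^bsub>V i\<^esub> v i) \<in> carrier D"
        using v ab by (auto simp: carrier_direct_sum intro!: abelian_group.a_inv_closed)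
      moreover have "v \<oplus>\<^bsub>D\<^esub> (\<lambda>i\<in>A. \<ominus>\<^bsub>V i\<^esub> v i) = \<zero>\<^bsub>D\<^esub>"
        using v ab by (auto simp: carrier_direct_sum add_direct_sum zero_direct_sum
            abelian_group.r_neg PiE_iff intro!: restrict_ext)
      ultimately show "\<exists>w\<in>carrier D. v \<oplus>\<^bsub>D\<^esub> w = \<zero>\<^bsub>D\<^esub>" by blast
    qed
    show "\<forall>v\<in>carrier D. v \<oplus>\<^bsub>D\<^esub> \<zero>\<^bsub>D\<^esub> = v"
      using ac by (auto simp: carrier_direct_sum add_direct_sum zero_direct_sum PiE_iff
          abelian_monoid.r_zero intro!: extensionalityI[of _ A])
    show "\<forall>v\<in>carrier D. \<one>\<^bsub>K\<^esub> \<odot>\<^bsub>D\<^esub> v = v"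
      using V by (auto simp: carrier_direct_sum smult_direct_sum PiE_iff
          module.smult_one intro!: extensionalityI[of _ A])
  next
    show "\<forall>v w. v \<in> carrier D \<and> w \<in> carrier D \<longrightarrow> v \<oplus>\<^bsub>D\<^esub> w = w \<oplus>\<^bsub>D\<^esub> v"
      using ac by (auto simp: carrier_direct_sum add_direct_sum PiE_iff
          abelian_monoid.a_comm intro!: restrict_ext)
    show "\<forall>v w x. v \<in> carrier D \<and> w \<in> carrier D \<and> x \<in> carrier D \<longrightarrow>
        v \<oplus>\<^bsub>D\<^esub> w \<oplus>\<^bsub>D\<^esub> x = v \<oplus>\<^bsub>D\<^esub> (w \<oplus>\<^bsub>D\<^esub> x)"
      using ac by (auto simp: carrier_direct_sum add_direct_sum PiE_iff
          abelian_monoid.a_assoc intro!: restrict_ext)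
  qed (auto simp: carrier_direct_sum add_direct_sum smult_direct_sum PiE_iff
      module.smult_l_distr[OF mod] module.smult_r_distr[OF mod] module.smult_assoc1[OF mod]
      intro!: restrict_ext)
qed

lemma direct_sum_inj_closed:
  assumes "a \<in> A" "v \<in> carrier (V a)"
  shows "direct_sum_inj A V a v \<in> carrier D"
proof -
  have "{i \<in> A. direct_sum_inj A V a v i \<noteq> \<zero>\<^bsub>V i\<^esub>} \<subseteq> {a}"
    by (auto simp: direct_sum_inj_def)
  then show ?thesis
    using assms vectorspace_V
    by (auto simp: carrier_direct_sum direct_sum_inj_def vectorspace_def module_def
        abelian_group_def abelian_monoid.zero_closed finite_subset)
qed

lemma linear_map_direct_sum_inj:
  assumes "a \<in> A"
  shows "linear_map K (V a) D (direct_sum_inj A V a)"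
proof -
  interpret D: vectorspace K D by (rule vectorspace_direct_sum)
  interpret V: vectorspace K "V a" by (rule vectorspace_V) fact
  note V = vectorspace_V[unfolded vectorspace_def]
  have "module K (V i)" "abelian_monoid (V i)" if "i \<in> A" for i
    using V[OF that] by (auto simp: module_def abelian_group_def)
  then have "\<zero>\<^bsub>V i\<^esub> \<oplus>\<^bsub>V i\<^esub> \<zero>\<^bsub>V i\<^esub> = \<zero>\<^bsub>V i\<^esub>"
    "c \<in> carrier K \<Longrightarrow> c \<odot>\<^bsub>V i\<^esub> \<zero>\<^bsub>V i\<^esub> = \<zero>\<^bsub>V i\<^esub>" if "i \<in> A" for c i
    using that module.smult_r_null[of K "V i" c]
    by (auto simp: abelian_monoid.l_zero abelian_monoid.zero_closed)
  then show ?thesis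
    using direct_sum_inj_closed[OF assms]
    by unfold_locales (auto simp: module_hom_def direct_sum_inj_def add_direct_sum
        smult_direct_sum intro!: restrict_ext)
qed

end

section \<open>Rank invariants in interval coordinates\<close>

text \<open>A direct sum decomposition of a diagram into interval modules with supports \<open>B b\<close>, \<open>b \<in> A\<close>,
  in terms of the coordinates \<open>c p v b\<close> of the vectors \<open>v\<close> at \<open>p\<close>.\<close>

locale interval_coordinates =
  fixes K :: "('k, 'm) ring_scheme" (structure)
    and F :: "('p::order, 'k, 'v) diagram"
    and A :: "'b set" and B :: "'b \<Rightarrow> 'p set" and c :: "'p \<Rightarrow> 'v \<Rightarrow> 'b \<Rightarrow> 'k"
  assumes field_K: "field K"
    and functor_F: "functor_to_vec K F"
    and c_closed: "\<lbrakk>v \<in> carrier (obj F p); b \<in> A\<rbrakk> \<Longrightarrow> c p v b \<in> carrier K"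
    and c_add: "\<lbrakk>v \<in> carrier (obj F p); w \<in> carrier (obj F p); b \<in> A\<rbrakk> \<Longrightarrow>
      c p (v \<oplus>\<^bsub>obj F p\<^esub> w) b = c p v b \<oplus> c p w b"
    and c_smult: "\<lbrakk>r \<in> carrier K; v \<in> carrier (obj F p); b \<in> A\<rbrakk> \<Longrightarrow>
      c p (r \<odot>\<^bsub>obj F p\<^esub> v) b = r \<otimes> c p v b"
    and c_outside: "\<lbrakk>v \<in> carrier (obj F p); b \<in> A; p \<notin> B b\<rbrakk> \<Longrightarrow> c p v b = \<zero>"
    and c_arr: "\<lbrakk>p \<le> q; v \<in> carrier (obj F p); b \<in> A\<rbrakk> \<Longrightarrow>
      c q (arr F p q v) b = (if q \<in> B b then c p v b else \<zero>)"
    and c_finite: "v \<in> carrier (obj F p) \<Longrightarrow> finite {b \<in> A. c p v b \<noteq> \<zero>}"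
    and c_ext: "\<lbrakk>v \<in> carrier (obj F p); w \<in> carrier (obj F p); \<And>b. b \<in> A \<Longrightarrow> c p v b = c p w b\<rbrakk> \<Longrightarrow> v = w"
    and c_surj: "\<lbrakk>f \<in> A \<rightarrow> carrier K; finite {b \<in> A. f b \<noteq> \<zero>}; \<And>b. b \<in> A \<Longrightarrow> p \<notin> B b \<Longrightarrow> f b = \<zero>\<rbrakk> \<Longrightarrow>
      \<exists>v\<in>carrier (obj F p). \<forall>b\<in>A. c p v b = f b"
begin

sublocale K: field K by (rule field_K)

lemma vectorspace_obj: "vectorspace K (obj F p)"
  and fin_dim_obj: "vectorspace.fin_dim K (obj F p)"
  and linear_map_arr: "p \<le> q \<Longrightarrow> linear_map K (obj F p) (obj F q) (arr F p q)"
  using functor_F by (simp_all add: functor_to_vec_def)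

sublocale obj: vectorspace K "obj F p" for p
  by (rule vectorspace_obj)

lemma arr_closed: "p \<le> q \<Longrightarrow> v \<in> carrier (obj F p) \<Longrightarrow> arr F p q v \<in> carrier (obj F q)"
  by (rule mod_hom.f_im[OF linear_map.axioms(3)[OF linear_map_arr]])

lemma c_zero: "b \<in> A \<Longrightarrow> c p \<zero>\<^bsub>obj F p\<^esub> b = \<zero>"
  using c_smult[of \<zero> "\<zero>\<^bsub>obj F p\<^esub>" p b] c_closed[of "\<zero>\<^bsub>obj F p\<^esub>" p b] by simp

text \<open>The coordinates are cut off outside the supports so that one finitely supported
  \<open>f\<close> can be used at every point \<open>p\<close>. By \<open>c_ext\<close> the chosen
  vector is unique.\<close>

definition vec :: "'p \<Rightarrow> ('b \<Rightarrow> 'k) \<Rightarrow> 'v" where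
  "vec p f = (SOME v. v \<in> carrier (obj F p) \<and> (\<forall>b\<in>A. c p v b = (if p \<in> B b then f b else \<zero>)))"

lemma
  assumes "f \<in> A \<rightarrow> carrier K" and "finite {b \<in> A. f b \<noteq> \<zero>}"
  shows vec_closed: "vec p f \<in> carrier (obj F p)"
    and c_vec: "b \<in> A \<Longrightarrow> c p (vec p f) b = (if p \<in> B b then f b else \<zero>)"
proof -
  have "finite {b \<in> A. (if p \<in> B b then f b else \<zero>) \<noteq> \<zero>}"
    by (rule finite_subset[OF _ assms(2)]) auto
  then have "\<exists>v\<in>carrier (obj F p). \<forall>b\<in>A. c p v b = (if p \<in> B b then f b else \<zero>)"
    using assms(1) by (intro c_surj) auto
  then have "vec p f \<in> carrier (obj F p) \<and> (\<forall>b\<in>A. c p (vec p f) b = (if p \<in> B b then f b else \<zero>))"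
    unfolding vec_def Bex_def by (rule someI_ex)
  then show "vec p f \<in> carrier (obj F p)"
    "b \<in> A \<Longrightarrow> c p (vec p f) b = (if p \<in> B b then f b else \<zero>)" by auto
qed

text \<open>Otherwise one more support than the dimension could be picked, and reading off these
  coordinates would map the space at \<open>p\<close> onto a space of larger dimension.\<close>

lemma finite_supports_at: "finite {b \<in> A. p \<in> B b}"
proof (rule ccontr)
  assume "infinite {b \<in> A. p \<in> B b}"
  then obtain S where S: "finite S" "card S = Suc (vectorspace.dim K (obj F p))" "S \<subseteq> {b \<in> A. p \<in> B b}"
    using infinite_arbitrarily_large by blast
  define T where "T v = (\<lambda>b\<in>S. c p v b)" for v
  interpret fs: vectorspace K "K.func_space S"
    by (intro vectorspace.intro K.func_space_is_module field_K)
  have "T \<in> module_hom K (obj F p) (K.func_space S)"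
    using S(3) c_closed c_add c_smult
    by (auto simp: module_hom_def T_def K.func_space_def intro!: restrict_ext)
  then interpret T: linear_map K "obj F p" "K.func_space S" T
    by unfold_locales
  have "T ` carrier (obj F p) = carrier (K.func_space S)"
  proof (intro equalityI subsetI)
    fix f assume f: "f \<in> carrier (K.func_space S)"
    \<comment> \<open>Extension by zero, which makes \<open>vec p g\<close> a preimage of
      \<open>f\<close>; no coordinate is cut off, since every \<open>b \<in> S\<close> has
      \<open>p\<close> in its support.\<close>
    define g where "g b = (if b \<in> S then f b else \<zero>)" for b
    have "{b \<in> A. g b \<noteq> \<zero>} \<subseteq> S" by (auto simp: g_def)
    then have g: "g \<in> A \<rightarrow> carrier K" "finite {b \<in> A. g b \<noteq> \<zero>}"
      using f S(1) by (auto simp: g_def K.func_space_def intro: finite_subset)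
    have "T (vec p g) = f"
      using f S(3) by (intro extensionalityI[of _ S])
        (auto simp: T_def K.func_space_def PiE_iff c_vec[OF g] g_def)
    then show "f \<in> T ` carrier (obj F p)"
      using vec_closed[OF g] by blast
  qed auto
  then have "card S \<le> vectorspace.dim K (obj F p)"
    using S(1) fin_dim_obj T.linear_map_axioms by (intro card_le_dim_if_surj_func_space)
  then show False using S(2) by simp
qed

end

section \<open>The colimit over a fixed connected set\<close>

locale interval_coordinates_on = interval_coordinates K F A B c
  for K :: "('k, 'm) ring_scheme" (structure)
    and F :: "('p::order, 'k, 'v) diagram"
    and A :: "'b set" and B :: "'b \<Rightarrow> 'p set" and c :: "'p \<Rightarrow> 'v \<Rightarrow> 'b \<Rightarrow> 'k" +
  fixes J :: "'p set"
  assumes J_nonempty: "J \<noteq> {}" and J_connected: "poset_connected J"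
begin

sublocale DS: vector_direct_sum K J "obj F"
  by (intro vector_direct_sum.intro field_K vectorspace_obj)

abbreviation "D \<equiv> direct_sum_space J (obj F)"
abbreviation "\<iota> \<equiv> direct_sum_inj J (obj F)"
abbreviation "N \<equiv> colimit_relations K F J"
abbreviation "C \<equiv> colimit_space K F J"
abbreviation "\<kappa> \<equiv> colimit_map K F J"

sublocale D: vectorspace K D
  by (rule DS.vectorspace_direct_sum)

definition relators where
  "relators = {\<iota> p v \<ominus>\<^bsub>D\<^esub> \<iota> q (arr F p q v) | p q v.
    p \<in> J \<and> q \<in> J \<and> p \<le> q \<and> v \<in> carrier (obj F p)}"

lemma N_eq: "N = D.span relators"
  by (simp add: colimit_relations_def relators_def Let_def)

lemma relators_subset: "relators \<subseteq> carrier D"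
  unfolding relators_def using DS.direct_sum_inj_closed arr_closed by (auto intro!: D.minus_closed)

sublocale Q: vector_quotient K D N
proof (intro vector_quotient.intro vector_quotient_axioms.intro D.vectorspace_axioms)
  show "subspace K N D"
    unfolding N_eq by (rule D.span_is_subspace[OF relators_subset])
qed

sublocale C: vectorspace K C
  unfolding colimit_space_def by (rule Q.vectorspace_quotient_space)

text \<open>The structure map of the colimit is the injection into the direct sum followed by the
  quotient map.\<close>

lemma linear_map_\<kappa>:
  assumes "p \<in> J"
  shows "linear_map K (obj F p) C (\<kappa> p)"
proof -
  interpret i: linear_map K "obj F p" D "\<iota> p"
    by (rule DS.linear_map_direct_sum_inj[OF assms])
  interpret q: linear_map K D "quotient_space D N" "\<lambda>x. N +>\<^bsub>D\<^esub> x"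
    by (rule Q.linear_map_coset)
  have "\<kappa> p \<in> module_hom K (obj F p) C"
    unfolding module_hom_def colimit_map_def colimit_space_def
    by auto
  then show ?thesis
    by unfold_locales
qed

lemma
  assumes "p \<in> J" "v \<in> carrier (obj F p)"
  shows \<kappa>_closed: "\<kappa> p v \<in> carrier C"
    and \<kappa>_add: "w \<in> carrier (obj F p) \<Longrightarrow> \<kappa> p (v \<oplus>\<^bsub>obj F p\<^esub> w) = \<kappa> p v \<oplus>\<^bsub>C\<^esub> \<kappa> p w"
    and \<kappa>_smult: "r \<in> carrier K \<Longrightarrow> \<kappa> p (r \<odot>\<^bsub>obj F p\<^esub> v) = r \<odot>\<^bsub>C\<^esub> \<kappa> p v"
proof -
  interpret \<kappa>: linear_map K "obj F p" C "\<kappa> p"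
    by (rule linear_map_\<kappa>[OF assms(1)])
  show "\<kappa> p v \<in> carrier C"
    "w \<in> carrier (obj F p) \<Longrightarrow> \<kappa> p (v \<oplus>\<^bsub>obj F p\<^esub> w) = \<kappa> p v \<oplus>\<^bsub>C\<^esub> \<kappa> p w"
    "r \<in> carrier K \<Longrightarrow> \<kappa> p (r \<odot>\<^bsub>obj F p\<^esub> v) = r \<odot>\<^bsub>C\<^esub> \<kappa> p v"
    using assms(2) by simp_all
qed

lemma \<kappa>_zero: "p \<in> J \<Longrightarrow> \<kappa> p \<zero>\<^bsub>obj F p\<^esub> = \<zero>\<^bsub>C\<^esub>"
  using linear_map.axioms(3)[OF linear_map_\<kappa>] by (rule mod_hom.f0_is_0)

text \<open>The cocone condition: the difference of the two representatives is one of the generators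
  of \<open>N\<close>.\<close>

lemma \<kappa>_arr:
  assumes "p \<in> J" "q \<in> J" "p \<le> q" "v \<in> carrier (obj F p)"
  shows "\<kappa> q (arr F p q v) = \<kappa> p v"
proof -
  have "\<iota> p v \<ominus>\<^bsub>D\<^esub> \<iota> q (arr F p q v) \<in> N"
    unfolding N_eq using assms
    by (intro D.span_mem[OF relators_subset]) (auto simp: relators_def)
  then show ?thesis
    unfolding colimit_map_def
    using Q.coset_eq_iff[of "\<iota> p v" "\<iota> q (arr F p q v)"] assms
    by (simp add: DS.direct_sum_inj_closed arr_closed)
qed

section \<open>Sections and their components\<close>

abbreviation "L \<equiv> carrier (limit_space F J)"

lemma L_iff:
  "s \<in> L \<longleftrightarrow> s \<in> (\<Pi>\<^sub>E p\<in>J. carrier (obj F p)) \<and> (\<forall>p\<in>J. \<forall>q\<in>J. p \<le> q \<longrightarrow> arr F p q (s p) = s q)"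
  by (simp add: limit_space_def pointwise_space_def)

text \<open>For comparable points this is \<open>\<kappa>_arr\<close>; connectedness of
  \<open>J\<close> carries it along a chain of comparable points. A section can therefore be
  evaluated wherever it is simplest.\<close>

lemma \<kappa>_section_indep:
  assumes "s \<in> L" "p \<in> J" "q \<in> J"
  shows "\<kappa> p (s p) = \<kappa> q (s q)"
proof -
  have step: "\<kappa> x (s x) = \<kappa> y (s y)" if "x \<in> J" "y \<in> J" "x \<le> y" for x y
    using \<kappa>_arr[of x y "s x"] assms(1) that by (auto simp: L_iff)
  have "(p, q) \<in> (Restr {(x, y). x \<le> y \<or> y \<le> x} J)\<^sup>*"
    using J_connected assms by (auto simp: poset_connected_def)
  then show ?thesis
    by (induction rule: rtrancl_induct) (auto dest: step)
qed

text \<open>The projection of a section to the partial direct sum over the indices in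
  \<open>S\<close>.\<close>

definition restr :: "'b set \<Rightarrow> ('p \<Rightarrow> 'v) \<Rightarrow> 'p \<Rightarrow> 'v" where
  "restr S s = (\<lambda>p\<in>J. vec p (\<lambda>b. if b \<in> S then c p (s p) b else \<zero>))"

lemma
  assumes "s \<in> L" "p \<in> J"
  shows restr_closed: "restr S s p \<in> carrier (obj F p)"
    and c_restr: "b \<in> A \<Longrightarrow> c p (restr S s p) b = (if b \<in> S then c p (s p) b else \<zero>)"
proof -
  let ?f = "\<lambda>b. if b \<in> S then c p (s p) b else \<zero>"
  have sp: "s p \<in> carrier (obj F p)"
    using assms by (auto simp: L_iff)
  have f: "?f \<in> A \<rightarrow> carrier K"
    using c_closed[OF sp] by auto
  have fin: "finite {b \<in> A. ?f b \<noteq> \<zero>}"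
    by (rule finite_subset[OF _ c_finite[OF sp]]) auto
  show "restr S s p \<in> carrier (obj F p)"
    using vec_closed[OF f fin] assms(2) by (simp add: restr_def)
  \<comment> \<open>The cut-off in \<open>vec\<close> changes nothing here, since the coordinate of
    \<open>s p\<close> already vanishes outside the support.\<close>
  show "c p (restr S s p) b = ?f b" if "b \<in> A"
    using c_vec[OF f fin that] assms(2) c_outside[OF sp that] by (simp add: restr_def)
qed

text \<open>Structure maps act on each coordinate separately, so they commute with the
  projection.\<close>

lemma restr_section:
  assumes "s \<in> L"
  shows "restr S s \<in> L"
proof -
  have "arr F p q (restr S s p) = restr S s q" if "p \<in> J" "q \<in> J" "p \<le> q" for p q
  proof (rule c_ext)
    fix b assume b: "b \<in> A"
    have sp: "s p \<in> carrier (obj F p)" and sq: "arr F p q (s p) = s q"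
      using assms that by (auto simp: L_iff)
    have "c q (s q) b = (if q \<in> B b then c p (s p) b else \<zero>)"
      using c_arr[OF that(3) sp b] sq by simp
    then show "c q (arr F p q (restr S s p)) b = c q (restr S s q) b"
      using c_arr[OF that(3) restr_closed[OF assms that(1)] b] assms that b
      by (simp add: c_restr)
  qed (use assms that restr_closed arr_closed in blast)+
  then show ?thesis
    using restr_closed[OF assms] by (auto simp: L_iff restr_def)
qed

text \<open>The component of a section at an interval that does not contain \<open>J\<close> vanishes at some point of
  \<open>J\<close>, hence its class in the colimit is zero.\<close>

lemma \<kappa>_restr_single:
  assumes "s \<in> L" "b \<in> A" "\<not> J \<subseteq> B b" "a \<in> J"
  shows "\<kappa> a (restr {b} s a) = \<zero>\<^bsub>C\<^esub>"
proof -
  obtain p where p: "p \<in> J" "p \<notin> B b"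
    using assms(3) by blast
  have sp: "s p \<in> carrier (obj F p)"
    using assms p by (auto simp: L_iff)
  have "restr {b} s p = \<zero>\<^bsub>obj F p\<^esub>"
    using assms p c_outside[OF sp]
    by (intro c_ext[of _ p]) (auto simp: restr_closed c_restr c_zero)
  then show ?thesis
    using \<kappa>_section_indep[OF restr_section[OF assms(1)] assms(4) p(1)] \<kappa>_zero[OF p(1)] by simp
qed

text \<open>Induction from the case of one index by linearity of \<open>\<kappa> a\<close>. Finite
  sets suffice because a vector has only finitely many nonzero coordinates.\<close>

lemma \<kappa>_restr_finite:
  assumes "s \<in> L" "a \<in> J" "finite S" "S \<subseteq> {b \<in> A. \<not> J \<subseteq> B b}"
  shows "\<kappa> a (restr S s a) = \<zero>\<^bsub>C\<^esub>"
  using assms(3,4)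
proof (induction S rule: finite_induct)
  case empty
  have "restr {} s a = \<zero>\<^bsub>obj F a\<^esub>"
    using assms by (intro c_ext[of _ a]) (auto simp: restr_closed c_restr c_zero)
  then show ?case using \<kappa>_zero assms by simp
next
  case (insert b S)
  have sa: "s a \<in> carrier (obj F a)"
    using assms by (auto simp: L_iff)
  have "restr (insert b S) s a = restr {b} s a \<oplus>\<^bsub>obj F a\<^esub> restr S s a"
  proof (rule c_ext[of _ a])
    fix x assume "x \<in> A"
    then show "c a (restr (insert b S) s a) x = c a (restr {b} s a \<oplus>\<^bsub>obj F a\<^esub> restr S s a) x"
      using assms insert.hyps c_closed[OF sa] by (auto simp: c_add c_restr restr_closed)
  qed (use assms restr_closed in auto)
  then show ?case
    using insert assms \<kappa>_restr_single[of s b a] by (simp add: \<kappa>_add restr_closed)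
qed

section \<open>Coordinate functionals on the colimit\<close>

definition coord :: "'b \<Rightarrow> ('p \<Rightarrow> 'v) \<Rightarrow> 'k" where
  "coord b x = (\<Oplus>p\<in>{p \<in> J. x p \<noteq> \<zero>\<^bsub>obj F p\<^esub>}. c p (x p) b)"

text \<open>The sum in \<open>coord\<close> runs over the support of \<open>x\<close> because
  \<open>J\<close> may be infinite. A larger finite index set only adds terms that vanish by
  \<open>c_zero\<close>.\<close>

lemma coord_eq_finsum:
  assumes "x \<in> carrier D" "b \<in> A" "finite X" "X \<subseteq> J" "{p \<in> J. x p \<noteq> \<zero>\<^bsub>obj F p\<^esub>} \<subseteq> X"
  shows "coord b x = (\<Oplus>p\<in>X. c p (x p) b)"
proof -
  have "c p (x p) b \<in> carrier K" if "p \<in> J" for p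
    using assms(1,2) that by (auto simp: DS.carrier_direct_sum intro!: c_closed)
  then show ?thesis
    unfolding coord_def using assms c_zero[OF assms(2)]
    by (intro K.add.finprod_mono_neutral_cong_left) auto
qed

lemma coord_\<iota>:
  assumes "p \<in> J" "v \<in> carrier (obj F p)" "b \<in> A"
  shows "coord b (\<iota> p v) = c p v b"
proof -
  have "coord b (\<iota> p v) = (\<Oplus>q\<in>{p}. c q (\<iota> p v q) b)"
    using assms by (intro coord_eq_finsum DS.direct_sum_inj_closed) (auto simp: direct_sum_inj_def)
  also have "\<dots> = c p v b"
    using assms c_closed by (simp add: direct_sum_inj_def)
  finally show ?thesis .
qed

lemma
  assumes "x \<in> carrier D" "b \<in> A"
  shows coord_closed: "coord b x \<in> carrier K"
    and coord_add: "y \<in> carrier D \<Longrightarrow> coord b (x \<oplus>\<^bsub>D\<^esub> y) = coord b x \<oplus> coord b y"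
    and coord_smult: "r \<in> carrier K \<Longrightarrow> coord b (r \<odot>\<^bsub>D\<^esub> x) = r \<otimes> coord b x"
proof -
  have x: "x p \<in> carrier (obj F p)" if "p \<in> J" for p
    using assms that by (auto simp: DS.carrier_direct_sum)
  have cx: "(\<lambda>p. c p (x p) b) \<in> J \<rightarrow> carrier K"
    using x assms(2) c_closed by auto
  let ?s = "\<lambda>x. {p \<in> J. x p \<noteq> \<zero>\<^bsub>obj F p\<^esub>}"
  have fin: "finite (?s x)"
    using assms by (simp add: DS.carrier_direct_sum)
  show "coord b x \<in> carrier K"
    unfolding coord_def using cx by (intro K.finsum_closed) auto
  show "coord b (x \<oplus>\<^bsub>D\<^esub> y) = coord b x \<oplus> coord b y" if y: "y \<in> carrier D"
  proof -
    \<comment> \<open>A common index set for \<open>x\<close>, \<open>y\<close> and their sum, whose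
      support may be smaller because of cancellation.\<close>
    let ?X = "?s x \<union> ?s y"
    have yp: "y p \<in> carrier (obj F p)" if "p \<in> J" for p
      using y that by (auto simp: DS.carrier_direct_sum)
    have cy: "(\<lambda>p. c p (y p) b) \<in> J \<rightarrow> carrier K"
      using yp assms(2) c_closed by auto
    have X: "finite ?X" "?X \<subseteq> J"
      using fin y by (auto simp: DS.carrier_direct_sum)
    have "x \<oplus>\<^bsub>D\<^esub> y \<in> carrier D"
      using assms y by simp
    then have "coord b (x \<oplus>\<^bsub>D\<^esub> y) = (\<Oplus>p\<in>?X. c p ((x \<oplus>\<^bsub>D\<^esub> y) p) b)"
      using assms(2) X by (rule coord_eq_finsum) (auto simp: DS.add_direct_sum)
    also have "\<dots> = (\<Oplus>p\<in>?X. c p (x p) b \<oplus> c p (y p) b)"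
      using cx cy x yp assms(2)
      by (intro K.finsum_cong') (auto simp: DS.add_direct_sum c_add)
    also have "\<dots> = (\<Oplus>p\<in>?X. c p (x p) b) \<oplus> (\<Oplus>p\<in>?X. c p (y p) b)"
      using cx cy by (intro K.finsum_addf) auto
    also have "\<dots> = coord b x \<oplus> coord b y"
      using X assms y coord_eq_finsum[of x b ?X] coord_eq_finsum[of y b ?X] by auto
    finally show ?thesis .
  qed
  show "coord b (r \<odot>\<^bsub>D\<^esub> x) = r \<otimes> coord b x" if r: "r \<in> carrier K"
  proof -
    have "r \<odot>\<^bsub>D\<^esub> x \<in> carrier D"
      using assms r by simp
    then have "coord b (r \<odot>\<^bsub>D\<^esub> x) = (\<Oplus>p\<in>?s x. c p ((r \<odot>\<^bsub>D\<^esub> x) p) b)"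
      using assms(2) fin by (rule coord_eq_finsum) (use r in \<open>auto simp: DS.smult_direct_sum\<close>)
    also have "\<dots> = (\<Oplus>p\<in>?s x. r \<otimes> c p (x p) b)"
      using cx r x assms(2)
      by (intro K.finsum_cong') (auto simp: DS.smult_direct_sum c_smult)
    also have "\<dots> = r \<otimes> coord b x"
      unfolding coord_def using fin cx r by (intro K.finsum_rdistr[symmetric]) auto
    finally show ?thesis .
  qed
qed

lemma coord_zero: "b \<in> A \<Longrightarrow> coord b \<zero>\<^bsub>D\<^esub> = \<zero>"
  by (simp add: coord_def DS.zero_direct_sum)

text \<open>If \<open>J \<subseteq> B b\<close>, the structure maps inside \<open>J\<close> preserve
  the coordinate at \<open>b\<close>, so \<open>coord b\<close> kills every generator of
  \<open>N\<close>. It thus factors through the colimit and can detect nonzero classes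
  there.\<close>

lemma coord_N:
  assumes "x \<in> N" "b \<in> A" "J \<subseteq> B b"
  shows "coord b x = \<zero>"
proof -
  let ?U = "{x \<in> carrier D. coord b x = \<zero>}"
  have sub: "submodule K ?U D"
    by unfold_locales (use assms(2) coord_add coord_smult coord_zero in auto)
  have "relators \<subseteq> ?U"
  proof
    fix y assume "y \<in> relators"
    then obtain p q v where y: "y = \<iota> p v \<ominus>\<^bsub>D\<^esub> \<iota> q (arr F p q v)" and
      pq: "p \<in> J" "q \<in> J" "p \<le> q" "v \<in> carrier (obj F p)"
      by (auto simp: relators_def)
    let ?i = "\<iota> p v" and ?j = "\<iota> q (arr F p q v)"
    have ij: "?i \<in> carrier D" "?j \<in> carrier D"
      using pq by (auto intro!: DS.direct_sum_inj_closed arr_closed)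
    have yD: "y \<in> carrier D"
      unfolding y using ij by (rule D.minus_closed)
    \<comment> \<open>The difference is rewritten as a sum so that additivity of
      \<open>coord b\<close> applies.\<close>
    have "y \<oplus>\<^bsub>D\<^esub> ?j = ?i"
      unfolding y a_minus_def using ij by (simp add: D.a_assoc D.l_neg)
    then have "coord b y \<oplus> coord b ?j = coord b ?i"
      using coord_add[OF yD assms(2) ij(2)] by simp
    moreover have "coord b ?j = coord b ?i"
      using pq assms(2,3) by (auto simp: coord_\<iota> arr_closed c_arr)
    ultimately have "coord b y = \<zero>"
      using coord_closed[OF yD assms(2)] coord_closed[OF ij(2) assms(2)]
        K.add.r_cancel_one[of "coord b ?j" "coord b y"] by simp
    then show "y \<in> ?U" using yD by simp
  qed
  then have "D.span relators \<subseteq> ?U"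
    using sub by (intro D.span_is_subset)
  then show ?thesis
    using assms(1) N_eq by blast
qed

section \<open>The image of the limit as a function space\<close>

abbreviation "S \<equiv> {b \<in> A. J \<subseteq> B b}"

text \<open>The same choice of point as in \<open>limit_to_colimit\<close>, so that the two
  evaluations agree literally.\<close>

definition base :: 'p where "base = (SOME a. a \<in> J)"

lemma base: "base \<in> J"
  unfolding base_def using J_nonempty by (simp add: some_in_eq)

lemma finite_S: "finite S"
  by (rule finite_subset[OF _ finite_supports_at[of base]]) (use base in blast)

text \<open>Members of the function space are \<open>undefined\<close> outside \<open>S\<close>,
  whereas \<open>vec\<close> needs field values on all of \<open>A\<close>.\<close>

definition ext0 :: "('b \<Rightarrow> 'k) \<Rightarrow> 'b \<Rightarrow> 'k" where
  "ext0 f b = (if b \<in> S then f b else \<zero>)"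

lemma
  assumes "f \<in> carrier (K.func_space S)"
  shows vec_ext0_closed: "vec p (ext0 f) \<in> carrier (obj F p)"
    and c_vec_ext0: "b \<in> A \<Longrightarrow> p \<in> J \<Longrightarrow> c p (vec p (ext0 f)) b = ext0 f b"
proof -
  have 1: "ext0 f \<in> A \<rightarrow> carrier K"
    using assms by (auto simp: ext0_def K.func_space_def)
  have 2: "finite {b \<in> A. ext0 f b \<noteq> \<zero>}"
    by (rule finite_subset[OF _ finite_S]) (auto simp: ext0_def)
  show "vec p (ext0 f) \<in> carrier (obj F p)"
    by (rule vec_closed[OF 1 2])
  show "c p (vec p (ext0 f)) b = ext0 f b" if "b \<in> A" "p \<in> J"
  proof -
    \<comment> \<open>For \<open>b \<in> S\<close> the point \<open>p \<in> J\<close> lies in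
      \<open>B b\<close>, so the cut-off in \<open>vec\<close> has no effect.\<close>
    have "ext0 f b = \<zero>" if "p \<notin> B b"
      using that \<open>p \<in> J\<close> by (auto simp: ext0_def)
    then show ?thesis
      using c_vec[OF 1 2 \<open>b \<in> A\<close>] by simp
  qed
qed

text \<open>This map will identify functions on \<open>S\<close> with the image of the limit in the
  colimit, whose dimension is the rank.\<close>

definition \<sigma> :: "('b \<Rightarrow> 'k) \<Rightarrow> ('p \<Rightarrow> 'v) set" where
  "\<sigma> f = \<kappa> base (vec base (ext0 f))"

lemma linear_map_\<sigma>: "linear_map K (K.func_space S) C \<sigma>"
proof -
  interpret fs: vectorspace K "K.func_space S"
    by (intro vectorspace.intro K.func_space_is_module field_K)
  \<comment> \<open>As \<open>vec\<close> is a choice, its linearity is checked on coordinates and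
    concluded by \<open>c_ext\<close>.\<close>
  have "vec base (ext0 (f \<oplus>\<^bsub>K.func_space S\<^esub> g)) =
      vec base (ext0 f) \<oplus>\<^bsub>obj F base\<^esub> vec base (ext0 g)"
    if "f \<in> carrier (K.func_space S)" "g \<in> carrier (K.func_space S)" for f g
  proof (rule c_ext[of _ base])
    fix b assume "b \<in> A"
    then show "c base (vec base (ext0 (f \<oplus>\<^bsub>K.func_space S\<^esub> g))) b =
        c base (vec base (ext0 f) \<oplus>\<^bsub>obj F base\<^esub> vec base (ext0 g)) b"
      using that base
      by (simp add: c_add vec_ext0_closed c_vec_ext0) (simp add: ext0_def K.func_space_def)
  qed (use that vec_ext0_closed in auto)
  moreover have "vec base (ext0 (r \<odot>\<^bsub>K.func_space S\<^esub> f)) = r \<odot>\<^bsub>obj F base\<^esub> vec base (ext0 f)"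
    if "r \<in> carrier K" "f \<in> carrier (K.func_space S)" for r f
  proof (rule c_ext[of _ base])
    fix b assume "b \<in> A"
    then show "c base (vec base (ext0 (r \<odot>\<^bsub>K.func_space S\<^esub> f))) b =
        c base (r \<odot>\<^bsub>obj F base\<^esub> vec base (ext0 f)) b"
      using that base
      by (simp add: c_smult vec_ext0_closed c_vec_ext0) (simp add: ext0_def K.func_space_def)
  qed (use that vec_ext0_closed in auto)
  ultimately have "\<sigma> \<in> module_hom K (K.func_space S) C"
    using base by (auto simp: module_hom_def \<sigma>_def \<kappa>_add \<kappa>_smult \<kappa>_closed vec_ext0_closed)
  then show ?thesis
    by unfold_locales
qed

text \<open>If \<open>\<sigma> f\<close> is zero, its representative lies in \<open>N\<close>, where
  all \<open>coord b\<close> with \<open>b \<in> S\<close> vanish; but \<open>coord b\<close>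
  returns the value \<open>f b\<close>.\<close>

lemma inj_on_\<sigma>: "inj_on \<sigma> (carrier (K.func_space S))"
proof -
  interpret \<sigma>: linear_map K "K.func_space S" C \<sigma>
    by (rule linear_map_\<sigma>)
  have "f = \<zero>\<^bsub>K.func_space S\<^esub>" if f: "f \<in> carrier (K.func_space S)" and "\<sigma> f = \<zero>\<^bsub>C\<^esub>" for f
  proof -
    let ?v = "vec base (ext0 f)"
    have v: "?v \<in> carrier (obj F base)" "\<iota> base ?v \<in> carrier D"
      using vec_ext0_closed[OF f] base by (auto intro: DS.direct_sum_inj_closed)
    have "N +>\<^bsub>D\<^esub> \<iota> base ?v = N"
      using that(2) by (simp add: \<sigma>_def colimit_map_def colimit_space_def quotient_space_def)
    then have N: "\<iota> base ?v \<in> N"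
      using Q.coset_eq_N_iff[OF v(2)] by simp
    have "f b = \<zero>" if b: "b \<in> S" for b
    proof -
      have "f b = c base ?v b"
        using b base f by (simp add: c_vec_ext0) (simp add: ext0_def)
      also have "\<dots> = \<zero>"
        using coord_N[OF N, of b] b coord_\<iota>[OF base v(1), of b] by simp
      finally show ?thesis .
    qed
    then show ?thesis
      using f by (intro extensionalityI[of _ S]) (auto simp: K.func_space_def PiE_iff)
  qed
  then have "carrier (K.func_space S\<lparr>carrier := \<sigma>.kerT\<rparr>) = {\<zero>\<^bsub>K.func_space S\<^esub>}"
    using \<sigma>.f0_is_0 by (auto simp: \<sigma>.ker_def)
  then show ?thesis
    by (rule \<sigma>.Ke0_imp_inj)
qed

text \<open>A function on \<open>S\<close> is realised by a section with constant coordinates.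
  Conversely, the value of a section at \<open>base\<close> splits into its part on \<open>S\<close>
  and a finite remainder whose class in the colimit is zero.\<close>

lemma image_\<sigma>: "\<sigma> ` carrier (K.func_space S) = limit_to_colimit K F J ` L"
proof (intro equalityI subsetI)
  fix x assume "x \<in> \<sigma> ` carrier (K.func_space S)"
  then obtain f where f: "f \<in> carrier (K.func_space S)" "x = \<sigma> f" by blast
  \<comment> \<open>This is a section because \<open>J \<subseteq> B b\<close> for all
    \<open>b \<in> S\<close>, so the structure maps keep these coordinates.\<close>
  define s where "s = (\<lambda>p\<in>J. vec p (ext0 f))"
  have "arr F p q (s p) = s q" if "p \<in> J" "q \<in> J" "p \<le> q" for p q
  proof (rule c_ext)
    fix b assume b: "b \<in> A"
    show "c q (arr F p q (s p)) b = c q (s q) b"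
      using that b f(1) c_arr[OF that(3) vec_ext0_closed[OF f(1)] b]
      by (simp add: s_def c_vec_ext0) (auto simp: ext0_def)
  qed (use that f vec_ext0_closed arr_closed in \<open>auto simp: s_def\<close>)
  then have "s \<in> L"
    using vec_ext0_closed[OF f(1)] by (auto simp: L_iff s_def)
  moreover have "limit_to_colimit K F J s = x"
    using base by (simp add: limit_to_colimit_def Let_def f(2) \<sigma>_def s_def flip: base_def)
  ultimately show "x \<in> limit_to_colimit K F J ` L" by blast
next
  fix x assume "x \<in> limit_to_colimit K F J ` L"
  then obtain s where s: "s \<in> L" and x: "x = \<kappa> base (s base)"
    by (auto simp: limit_to_colimit_def Let_def simp flip: base_def)
  have sb: "s base \<in> carrier (obj F base)"
    using s base by (auto simp: L_iff)
  define f where "f = (\<lambda>b\<in>S. c base (s base) b)"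
  have f: "f \<in> carrier (K.func_space S)"
    using c_closed[OF sb] by (auto simp: f_def K.func_space_def)
  \<comment> \<open>The nonzero coordinates at \<open>base\<close> that belong to summands not
    containing \<open>J\<close>; \<open>\<kappa>_restr_finite\<close> removes them.\<close>
  define R where "R = {b \<in> A. c base (s base) b \<noteq> \<zero>} - S"
  have R: "finite R" "R \<subseteq> {b \<in> A. \<not> J \<subseteq> B b}"
    using c_finite[OF sb] by (auto simp: R_def)
  have "s base = vec base (ext0 f) \<oplus>\<^bsub>obj F base\<^esub> restr R s base"
  proof (rule c_ext[of _ base])
    fix b assume b: "b \<in> A"
    have "c base (s base) b = ext0 f b \<oplus> (if b \<in> R then c base (s base) b else \<zero>)"
      using b c_closed[OF sb b] by (auto simp: ext0_def f_def R_def)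
    then show "c base (s base) b = c base (vec base (ext0 f) \<oplus>\<^bsub>obj F base\<^esub> restr R s base) b"
      using b base s f by (simp add: c_add c_restr restr_closed vec_ext0_closed c_vec_ext0)
  qed (use sb s base f vec_ext0_closed restr_closed in auto)
  then have "x = \<sigma> f"
    using x base s f \<kappa>_restr_finite[OF s base R] \<kappa>_closed[OF base vec_ext0_closed[OF f]]
    by (simp add: \<kappa>_add \<sigma>_def restr_closed vec_ext0_closed)
  then show "x \<in> \<sigma> ` carrier (K.func_space S)"
    using f by blast
qed

theorem rk_eq_card: "rk K F J = card {b \<in> A. J \<subseteq> B b}"
  using dim_image_func_space[OF linear_map_\<sigma> finite_S inj_on_\<sigma>]
  by (simp add: rk_def image_\<sigma>)

end

section \<open>Hasse-connected subsets\<close>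

lemma Con_poset_connected: "I \<in> Con \<Longrightarrow> poset_connected I"
proof -
  have "Restr {(x, y). x \<asymp> y} I \<subseteq> Restr {(x, y). x \<le> y \<or> y \<le> x} I"
    by (auto simp: hasse_adj_def covers_def)
  then show "I \<in> Con \<Longrightarrow> poset_connected I"
    unfolding Con_def poset_connected_def using rtrancl_mono by blast
qed

text \<open>Induction on the size of the closed segment from \<open>p\<close> to \<open>q\<close>,
  finite by local finiteness. Unless \<open>q\<close> equals or covers \<open>p\<close>, a point
  strictly between them, which lies in \<open>J\<close> by convexity, splits it into two smaller
  segments.\<close>

lemma hasse_path_in_convex_set:
  fixes J :: "'p::order set"
  assumes "locally_finite TYPE('p)"
    and "\<And>r s t. r \<in> J \<Longrightarrow> t \<in> J \<Longrightarrow> r \<le> s \<Longrightarrow> s \<le> t \<Longrightarrow> s \<in> J"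
    and "p \<in> J" "q \<in> J" "p \<le> q"
  shows "(p, q) \<in> (Restr {(x, y). x \<asymp> y} J)\<^sup>*"
  using assms(3-5)
proof (induction "card {p..q}" arbitrary: p q rule: less_induct)
  case less
  have "{p..q} = {r. p \<le> r \<and> r \<le> q}" by auto
  then have fin: "finite {p..q}"
    using assms(1) less.prems(3) by (simp add: locally_finite_def)
  consider "p = q" | "covers q p" | r where "p < r" "r < q"
    using less.prems(3) unfolding covers_def order.order_iff_strict by blast
  then show ?case
  proof cases
    case 2
    then show ?thesis
      using less.prems by (intro r_into_rtrancl) (simp add: hasse_adj_def)
  next
    case (3 r)
    then have le: "p \<le> r" "r \<le> q" by simp_all
    then have "r \<in> J"
      using assms(2) less.prems by blast
    moreover have "{p..r} \<subset> {p..q}" "{r..q} \<subset> {p..q}"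
      using 3 le by (simp_all add: atLeastatMost_psubset_iff)
    ultimately show ?thesis
      using le less.prems by (intro rtrancl_trans[of p r _ q] less.hyps psubset_card_mono[OF fin])
  qed simp
qed

text \<open>Each comparability in a connecting chain is replaced by a Hasse path that stays in the
  convex set.\<close>

lemma Intervals_subset_Con:
  assumes "locally_finite TYPE('p::order)"
  shows "Intervals \<subseteq> (Con :: 'p set set)"
proof
  fix J :: "'p set" assume J: "J \<in> Intervals"
  let ?H = "Restr {(x, y). x \<asymp> y} J"
  have sym: "sym (?H\<^sup>*)"
    by (intro sym_rtrancl symI) (auto simp: hasse_adj_def)
  have path: "(p, q) \<in> ?H\<^sup>*" if "p \<in> J" "q \<in> J" "p \<le> q" for p q
    using J that by (intro hasse_path_in_convex_set[OF assms]) (unfold Intervals_def, blast+)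
  have "Restr {(x, y). x \<le> y \<or> y \<le> x} J \<subseteq> ?H\<^sup>*"
    using path symD[OF sym path] by blast
  then have "(Restr {(x, y). x \<le> y \<or> y \<le> x} J)\<^sup>* \<subseteq> ?H\<^sup>*"
    by (rule rtrancl_subset_rtrancl)
  moreover have "J \<noteq> {}" and "\<forall>p\<in>J. \<forall>q\<in>J. (p, q) \<in> (Restr {(x, y). x \<le> y \<or> y \<le> x} J)\<^sup>*"
    using J unfolding Intervals_def poset_connected_def by blast+
  ultimately show "J \<in> Con"
    unfolding Con_def by (intro CollectI conjI ballI) (assumption, meson subsetD)
qed

text \<open>Every added point is adjacent to some point of \<open>I\<close>, so all points are
  joined to a fixed \<open>a \<in> I\<close>. Thus the rank formula applies to all
  enlargements.\<close>

lemma Con_Un_nbd: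
  assumes "I \<in> Con" and "T \<subseteq> nbd I"
  shows "I \<union> T \<in> Con"
proof -
  let ?H = "Restr {(x, y). x \<asymp> y} (I \<union> T)"
  obtain a where a: "a \<in> I"
    using assms(1) by (auto simp: Con_def)
  have sym: "sym (?H\<^sup>*)"
    by (intro sym_rtrancl symI) (auto simp: hasse_adj_def)
  have path_I: "(a, q) \<in> ?H\<^sup>*" if "q \<in> I" for q
  proof -
    have "(a, q) \<in> (Restr {(x, y). x \<asymp> y} I)\<^sup>*"
      using assms(1) a that by (auto simp: Con_def)
    moreover have "Restr {(x, y). x \<asymp> y} I \<subseteq> ?H" by blast
    then have "(Restr {(x, y). x \<asymp> y} I)\<^sup>* \<subseteq> ?H\<^sup>*" by (rule rtrancl_mono)
    ultimately show ?thesis by blast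
  qed
  have path: "(a, q) \<in> ?H\<^sup>*" if q: "q \<in> I \<union> T" for q
  proof (cases "q \<in> I")
    case False
    then obtain r where r: "r \<in> I" "r \<asymp> q"
      using q assms(2) unfolding nbd_def by blast
    then have "(r, q) \<in> ?H" using q by blast
    with path_I[OF r(1)] show ?thesis by (rule rtrancl_into_rtrancl)
  qed (rule path_I)
  have "(p, q) \<in> ?H\<^sup>*" if "p \<in> I \<union> T" "q \<in> I \<union> T" for p q
    using symD[OF sym path[OF that(1)]] path[OF that(2)] by (rule rtrancl_trans)
  then show ?thesis using a by (auto simp: Con_def)
qed

text \<open>A Hasse path in \<open>B\<close> that starts in \<open>I\<close> cannot leave
  \<open>I\<close>, as its first point outside would lie in \<open>nbd I \<inter> B\<close>.\<close>

lemma Con_eq_if_disjoint_nbd: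
  assumes "B \<in> Con" and "I \<subseteq> B" and "I \<noteq> {}" and "nbd I \<inter> B = {}"
  shows "B = I"
proof (intro equalityI subsetI)
  fix q assume "q \<in> B"
  obtain a where a: "a \<in> I" using assms(3) by blast
  have "(a, q) \<in> (Restr {(x, y). x \<asymp> y} B)\<^sup>*"
    using assms(1,2) a \<open>q \<in> B\<close> by (auto simp: Con_def)
  then show "q \<in> I"
    by (induction rule: rtrancl_induct) (use a assms(4) in \<open>auto simp: nbd_def\<close>)
qed (use assms(2) in blast)

text \<open>Expand the product of \<open>1 - 1\<close> over \<open>X\<close>; the empty product
  gives the exceptional value.\<close>

lemma sum_neg_one_power_card_Pow:
  assumes "finite X"
  shows "(\<Sum>T\<in>Pow X. (- 1) ^ card T) = (if X = {} then 1 else 0 :: int)"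
  using prod_diff_conv_sum[of X "\<lambda>_. 1 :: int" "\<lambda>_. 1"] assms
  by (simp add: power_0_left)

text \<open>Inclusion-exclusion: each index with support containing \<open>I\<close> contributes \<open>(1 - 1)\<close> to the
  power of the number of neighbours of \<open>I\<close> in its support.\<close>

lemma alternating_sum_enlargements:
  fixes B :: "'b \<Rightarrow> 'p::order set"
  assumes "I \<in> Con" and "finite (nbd I)" and "finite {b \<in> A. I \<subseteq> B b}"
    and "\<And>b. b \<in> A \<Longrightarrow> B b \<in> Con"
  shows "int (card {b \<in> A. I \<subseteq> B b})
      + (\<Sum>n = 1..perimeter I. (-1) ^ n * (\<Sum>J\<in>enlargements I n. int (card {b \<in> A. J \<subseteq> B b})))
    = int (card {b \<in> A. B b = I})"
proof -
  let ?N = "nbd I" and ?c = "\<lambda>J. int (card {b \<in> A. J \<subseteq> B b})"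
  let ?AI = "{b \<in> A. I \<subseteq> B b}"
  have disj: "I \<inter> ?N = {}" by (auto simp: nbd_def)
  \<comment> \<open>Enlargements by \<open>n\<close> points correspond to the subsets of
    \<open>nbd I\<close> of size \<open>n\<close>.\<close>
  have enl: "bij_betw (\<lambda>T. I \<union> T) {T \<in> Pow ?N. card T = n} (enlargements I n)" for n
    by (rule bij_betw_byWitness[where f' = "\<lambda>J. J \<inter> ?N"])
      (use disj in \<open>auto simp: enlargements_def Int_Un_distrib2 Int_absorb2 intro!: arg_cong[of _ _ card]\<close>)
  \<comment> \<open>The leading term is the summand for \<open>n = 0\<close>, since \<open>I\<close>
    is its only enlargement by no points.\<close>
  have "?c I + (\<Sum>n = 1..perimeter I. (-1) ^ n * (\<Sum>J\<in>enlargements I n. ?c J))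
      = (\<Sum>n = 0..card ?N. (-1) ^ n * (\<Sum>J\<in>enlargements I n. ?c J))"
  proof -
    have "{T \<in> Pow ?N. card T = 0} = {{}}"
      using assms(2) by (auto dest: finite_subset)
    then have "enlargements I 0 = {I}"
      using bij_betw_imp_surj_on[OF enl[of 0]] by simp
    then show ?thesis
      by (simp add: perimeter_def sum.atLeast_Suc_atMost)
  qed
  also have "\<dots> = (\<Sum>n = 0..card ?N. \<Sum>T | T \<in> Pow ?N \<and> card T = n. (-1) ^ card T * ?c (I \<union> T))"
    by (intro sum.cong refl)
      (simp add: sum.reindex_bij_betw[OF enl, symmetric] sum_distrib_left)
  also have "\<dots> = (\<Sum>T\<in>Pow ?N. (-1) ^ card T * ?c (I \<union> T))"
    using assms(2) by (intro sum.group) (auto intro: card_mono)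
  \<comment> \<open>Each cardinality becomes a sum of indicators over the indices whose support
    contains \<open>I\<close>.\<close>
  also have "\<dots> = (\<Sum>T\<in>Pow ?N. \<Sum>b\<in>?AI. if T \<subseteq> B b then (-1) ^ card T else 0)"
  proof (rule sum.cong[OF refl])
    fix T
    have "{b \<in> A. I \<union> T \<subseteq> B b} = ?AI \<inter> {b. T \<subseteq> B b}" by auto
    then have "?c (I \<union> T) = (\<Sum>b\<in>?AI. if T \<subseteq> B b then 1 else 0)"
      using assms(3) by (simp add: sum.If_cases)
    then show "(-1) ^ card T * ?c (I \<union> T) = (\<Sum>b\<in>?AI. if T \<subseteq> B b then (-1) ^ card T else 0)"
      by (simp add: sum_distrib_left if_distrib cong: if_cong)
  qed
  \<comment> \<open>After exchanging the sums, a fixed \<open>b\<close> sees only the subsets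
    \<open>T\<close> that lie in its own support.\<close>
  also have "\<dots> = (\<Sum>b\<in>?AI. \<Sum>T\<in>Pow (?N \<inter> B b). (-1) ^ card T)"
    by (subst sum.swap, rule sum.cong[OF refl])
      (use assms(2) in \<open>auto simp: sum.If_cases Int_def Pow_def intro!: sum.cong\<close>)
  also have "\<dots> = (\<Sum>b\<in>?AI. if B b = I then 1 else 0)"
  proof (rule sum.cong[OF refl])
    fix b assume b: "b \<in> ?AI"
    \<comment> \<open>From left to right this uses Hasse connectedness of \<open>B b\<close>; the
      converse is disjointness of \<open>I\<close> and \<open>nbd I\<close>.\<close>
    have "?N \<inter> B b = {} \<longleftrightarrow> B b = I"
      using Con_eq_if_disjoint_nbd[OF assms(4), of b I] b assms(1) disj by (auto simp: Con_def)
    then show "(\<Sum>T\<in>Pow (?N \<inter> B b). (-1) ^ card T) = (if B b = I then 1 else 0 :: int)"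
      using assms(2) by (subst sum_neg_one_power_card_Pow) simp_all
  qed
  also have "\<dots> = int (card {b \<in> A. B b = I})"
  proof -
    have "?AI \<inter> {b. B b = I} = {b \<in> A. B b = I}" by auto
    then show ?thesis using assms(3) by (simp add: sum.If_cases)
  qed
  finally show ?thesis .
qed

section \<open>Barcodes\<close>

text \<open>The isomorphism with the direct sum of interval modules supplies the coordinates: the
  component at the pair \<open>(J, i)\<close> is a field element, supported on
  \<open>J\<close>.\<close>

lemma interval_coordinates_of_barcode:
  assumes "field K" and "functor_to_vec K F" and "has_barcode K F m"
  obtains c where "interval_coordinates K F {(J, i). i < m J} fst c"
proof -
  let ?A = "{(J, i). i < m J}"
  let ?M = "\<lambda>(J, i). interval_module K J"
  let ?G = "diagram_direct_sum ?A ?M"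
  interpret K: field K by fact
  obtain \<eta> where lin: "\<And>p. linear_map K (obj F p) (obj ?G p) (\<eta> p)"
    and bij: "\<And>p. bij_betw (\<eta> p) (carrier (obj F p)) (carrier (obj ?G p))"
    and nat: "\<And>p q v. p \<le> q \<Longrightarrow> v \<in> carrier (obj F p) \<Longrightarrow> \<eta> q (arr F p q v) = arr ?G p q (\<eta> p v)"
    using assms(3) unfolding has_barcode_def diagram_iso_def by blast
  note hom = mod_hom.f_hom[OF linear_map.axioms(3)[OF lin]]
  have carrier_G: "carrier (obj ?G p) =
      {s \<in> (\<Pi>\<^sub>E b\<in>?A. if p \<in> fst b then carrier K else {\<zero>\<^bsub>K\<^esub>}). finite {b \<in> ?A. s b \<noteq> \<zero>\<^bsub>K\<^esub>}}" for p
    by (simp add: diagram_direct_sum_def direct_sum_space_def pointwise_space_def interval_module_def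
        case_prod_beta)
  have \<eta>_closed: "\<eta> p v \<in> carrier (obj ?G p)" if "v \<in> carrier (obj F p)" for p v
    using funcset_mem[OF module_hom_closed[OF hom] that] .
  have "interval_coordinates K F ?A fst \<eta>"
  proof
    fix v b p assume v: "v \<in> carrier (obj F p)" and b: "b \<in> ?A"
    have \<eta>v: "\<eta> p v b \<in> (if p \<in> fst b then carrier K else {\<zero>\<^bsub>K\<^esub>})"
      using \<eta>_closed[OF v] b unfolding carrier_G by blast
    then show "\<eta> p v b \<in> carrier K" by (auto split: if_splits)
    show "p \<notin> fst b \<Longrightarrow> \<eta> p v b = \<zero>\<^bsub>K\<^esub>"
      using \<eta>v by simp
    show "\<eta> p (v \<oplus>\<^bsub>obj F p\<^esub> w) b = \<eta> p v b \<oplus>\<^bsub>K\<^esub> \<eta> p w b" if "w \<in> carrier (obj F p)" for w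
      unfolding module_hom_add[OF hom v that] using b
      by (simp add: diagram_direct_sum_def direct_sum_space_def pointwise_space_def
          interval_module_def case_prod_beta)
    show "\<eta> p (r \<odot>\<^bsub>obj F p\<^esub> v) b = r \<otimes>\<^bsub>K\<^esub> \<eta> p v b" if "r \<in> carrier K" for r
      unfolding module_hom_smult[OF hom that v] using b
      by (simp add: diagram_direct_sum_def direct_sum_space_def pointwise_space_def
          interval_module_def case_prod_beta)
    show "\<eta> q (arr F p q v) b = (if q \<in> fst b then \<eta> p v b else \<zero>\<^bsub>K\<^esub>)" if "p \<le> q" for q
      unfolding nat[OF that v] using b \<eta>v
      by (auto simp: diagram_direct_sum_def interval_module_def split: if_splits)
  next
    fix v p assume "v \<in> carrier (obj F p)"
    then show "finite {b \<in> ?A. \<eta> p v b \<noteq> \<zero>\<^bsub>K\<^esub>}"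
      using \<eta>_closed unfolding carrier_G by blast
  next
    fix v w p assume vw: "v \<in> carrier (obj F p)" "w \<in> carrier (obj F p)"
      and "\<And>b. b \<in> ?A \<Longrightarrow> \<eta> p v b = \<eta> p w b"
    moreover have "\<eta> p v \<in> extensional ?A" "\<eta> p w \<in> extensional ?A"
      using \<eta>_closed[OF vw(1)] \<eta>_closed[OF vw(2)] unfolding carrier_G PiE_def by blast+
    ultimately have "\<eta> p v = \<eta> p w"
      by (intro extensionalityI[of _ ?A])
    then show "v = w"
      using vw bij[of p] by (auto simp: bij_betw_def dest: inj_onD)
  next
    fix f p assume f: "f \<in> ?A \<rightarrow> carrier K" "finite {b \<in> ?A. f b \<noteq> \<zero>\<^bsub>K\<^esub>}"
      "\<And>b. b \<in> ?A \<Longrightarrow> p \<notin> fst b \<Longrightarrow> f b = \<zero>\<^bsub>K\<^esub>"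
    \<comment> \<open>Elements of the direct sum are extensional, so \<open>f\<close> must be
      restricted to the index set before \<open>\<eta> p\<close> can be inverted on it.\<close>
    have "{b \<in> ?A. restrict f ?A b \<noteq> \<zero>\<^bsub>K\<^esub>} = {b \<in> ?A. f b \<noteq> \<zero>\<^bsub>K\<^esub>}" by auto
    then have "restrict f ?A \<in> carrier (obj ?G p)"
      unfolding carrier_G using f by (intro CollectI conjI restrict_PiE_iff[THEN iffD2]) auto
    then have "restrict f ?A \<in> \<eta> p ` carrier (obj F p)"
      unfolding bij_betw_imp_surj_on[OF bij] .
    then obtain v where v: "restrict f ?A = \<eta> p v" "v \<in> carrier (obj F p)"
      by (rule imageE)
    have "\<forall>b\<in>?A. \<eta> p v b = f b"
      unfolding v(1)[symmetric] by simp
    with v(2) show "\<exists>v\<in>carrier (obj F p). \<forall>b\<in>?A. \<eta> p v b = f b" ..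
  qed (rule assms)+
  then show thesis by (rule that)
qed

text \<open>It is stated for any multiplicity function \<open>m\<close> of a decomposition, since
  \<open>barcode\<close> is only known to be well defined after two such functions have been
  compared.\<close>

lemma alternating_sum_rk_eq_multiplicity:
  fixes F :: "('p::order, 'k, 'v) diagram" and I :: "'p set"
  assumes "field K" and "essentially_finite TYPE('p)" and "functor_to_vec K F"
    and "has_barcode K F m" and "I \<in> Con"
  shows "int (rk K F I)
      + (\<Sum>n = 1..perimeter I. (-1) ^ n * (\<Sum>J\<in>enlargements I n. int (rk K F J)))
    = int (m I)"
proof -
  let ?A = "{(J, i). i < m J}"
  obtain c where "interval_coordinates K F ?A fst c"
    using assms interval_coordinates_of_barcode by metis
  then interpret interval_coordinates K F ?A fst c .
  have rk: "rk K F J = card {b \<in> ?A. J \<subseteq> fst b}" if "J \<in> Con" for J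
  proof -
    interpret interval_coordinates_on K F ?A fst c J
      using that Con_poset_connected by unfold_locales (auto simp: Con_def)
    show ?thesis by (rule rk_eq_card)
  qed
  have enl: "J \<in> Con" if "J \<in> enlargements I n" for J n
  proof -
    have "J = I \<union> (J \<inter> nbd I)"
      using that by (auto simp: enlargements_def)
    then show ?thesis
      using Con_Un_nbd[OF assms(5), of "J \<inter> nbd I"] by simp
  qed
  obtain a where "a \<in> I"
    using assms(5) by (auto simp: Con_def)
  then have "finite {b \<in> ?A. I \<subseteq> fst b}"
    by (intro finite_subset[OF _ finite_supports_at[of a]]) blast
  moreover have "fst b \<in> Con" if "b \<in> ?A" for b
    using that assms(2,4) Intervals_subset_Con[where 'p = 'p]
    by (auto simp: has_barcode_def essentially_finite_def)
  moreover have "finite (nbd I)"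
    using assms(2,5) by (simp add: essentially_finite_def)
  moreover have "card {b \<in> ?A. fst b = I} = m I"
  proof -
    have "{b \<in> ?A. fst b = I} = {I} \<times> {..<m I}" by auto
    then show ?thesis by simp
  qed
  ultimately show ?thesis
    using alternating_sum_enlargements[OF assms(5), of ?A fst] rk[OF assms(5)] rk[OF enl]
    by simp
qed

theorem theorem3p14:
  fixes K :: "('k, 'm) ring_scheme"
    and F :: "('p::order, 'k, 'v) diagram"
    and I :: "'p set"
  assumes "field K"
    and "poset_connected (UNIV :: 'p set)"
    and "essentially_finite TYPE('p)"
    and "functor_to_vec K F"
    and "interval_decomposable K F"
    and "I \<in> Con"
  shows "let v = int (rk K F I)
               + (\<Sum>n = 1..perimeter I. (-1) ^ n * (\<Sum>J\<in>enlargements I n. int (rk K F J)))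
         in v = int (barcode K F I) \<and> (I \<notin> Intervals \<longrightarrow> v = 0)"
proof -
  obtain m where m: "has_barcode K F m"
    using assms(5) by (auto simp: interval_decomposable_def)
  note mult = alternating_sum_rk_eq_multiplicity[OF assms(1,3,4)]
  have outside: "m' J = 0" if "has_barcode K F m'" "J \<notin> Intervals" for m' J
    using that by (auto simp: has_barcode_def)
  \<comment> \<open>On \<open>Con\<close> both functions equal the same alternating sum of ranks;
    elsewhere both vanish, because intervals belong to \<open>Con\<close>.\<close>
  have "m' = m" if m': "has_barcode K F m'" for m'
  proof
    fix J
    show "m' J = m J"
    proof (cases "J \<in> Con")
      case True
      then show ?thesis
        using mult[OF m' True] mult[OF m True] by simp
    next
      case False
      then have "J \<notin> Intervals"
        using assms(3) Intervals_subset_Con[where 'p = 'p] by (auto simp: essentially_finite_def)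
      then show ?thesis
        using outside[OF m] outside[OF m'] by simp
    qed
  qed
  then have "barcode K F = m"
    unfolding barcode_def using m by (intro the_equality)
  then show ?thesis
    using mult[OF m assms(6)] outside[OF m] by (simp add: Let_def)
qed

end
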